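(* Let $\mathcal{K}$ be a field, let $n\ge 1$ be an integer and let $r=2n+8$. Let $\mathcal{R}=\mathcal{K}[\mathcal{M}]\subseteq\mathcal{K}[s,t]$ be the monomial ring attached to $(n,r)$ in the context. Then $\mathcal{R}$ is strictly $2$-Buchsbaum.
   Context: Let $\mathcal{K}$ be a field. For integers $n\ge 1$ and $r\ge 5$ put $b_1=r$, $b_2=2r-2$ and $a_i=2r+2i-1$ for $0\le i\le n$. Let $$\mathcal{M}=\{s^{a_n},\ s^{a_n-b_1}t^{b_1},\ s^{a_n-b_2}t^{b_2},\ s^{a_n-a_0}t^{a_0},\ s^{a_n-a_1}t^{a_1},\dots,s^{a_n-a_{n-1}}t^{a_{n-1}},\ t^{a_n}\}\subset\mathcal{K}[s,t],$$ and let $\mathcal{R}=\mathcal{K}[\mathcal{M}]$ be the $\mathcal{K}$-subalgebra of $\mathcal{K}[s,t]$ generated by $\mathcal{M}$, with homogeneous maximal ideal $\mathfrak{m}=(\mathcal{M})\mathcal{R}$. For $k\ge 1$, $\mathcal{R}$ is $k$-Buchsbaum if $\mathfrak{m}^kH^1_{\mathfrak{m}}(\mathcal{R})=0$ (local cohomology), and strictly $k$-Buchsbaum if $k$ is the least integer with this property, i.e. $\mathfrak{m}^kH^1_{\mathfrak{m}}(\mathcal{R})=0$ but $\mathfrak{m}^{k-1}H^1_{\mathfrak{m}}(\mathcal{R})\neq 0$ (where $\mathfrak{m}^0=\mathcal{R}$). *)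

theory Defs
  imports
    "HOL-Algebra.Ideal_Product"
    "HOL-Algebra.Generated_Rings"
    "HOL-Algebra.Module"
    "HOL-Library.Poly_Mapping"
    "HOL-Library.Product_Plus"
begin

section \<open>Injective resolutions and local cohomology\<close>

definition linear_map ::
    "('a, 'r) ring_scheme \<Rightarrow> ('a, 'b) module \<Rightarrow> ('a, 'c) module \<Rightarrow> ('b \<Rightarrow> 'c) \<Rightarrow> bool" where
  "linear_map R M N f \<longleftrightarrow>
     f \<in> carrier M \<rightarrow> carrier N \<and>
     (\<forall>x\<in>carrier M. \<forall>y\<in>carrier M. f (x \<oplus>\<^bsub>M\<^esub> y) = f x \<oplus>\<^bsub>N\<^esub> f y) \<and>
     (\<forall>a\<in>carrier R. \<forall>x\<in>carrier M. f (a \<odot>\<^bsub>M\<^esub> x) = a \<odot>\<^bsub>N\<^esub> f x)"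

text \<open>
  A HOL definition cannot quantify over all types, so the test modules \<open>A\<close>, \<open>B\<close> have their
  carriers in the type of ring elements. These include \<open>R\<close> and all its ideals, so by Baer's
  criterion this agrees with injectivity with respect to modules of arbitrary type.
\<close>
definition injective_module :: "('a, 'r) ring_scheme \<Rightarrow> ('a, 'b) module \<Rightarrow> bool" where
  "injective_module R E \<longleftrightarrow>
     module R E \<and>
     (\<forall>(A :: ('a, 'a) module) (B :: ('a, 'a) module) f g.
        module R A \<and> module R B \<and>
        linear_map R A B f \<and> inj_on f (carrier A) \<and> linear_map R A E g \<longrightarrow>
        (\<exists>h. linear_map R B E h \<and> (\<forall>x\<in>carrier A. h (f x) = g x)))"

definition injective_resolution ::
    "('a, 'r) ring_scheme \<Rightarrow> ('a, 'c) module \<Rightarrow> ('c \<Rightarrow> 'b) \<Rightarrow>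
     (nat \<Rightarrow> ('a, 'b) module) \<Rightarrow> (nat \<Rightarrow> 'b \<Rightarrow> 'b) \<Rightarrow> bool" where
  "injective_resolution R M \<epsilon> E d \<longleftrightarrow>
     module R M \<and>
     (\<forall>i. injective_module R (E i)) \<and>
     linear_map R M (E 0) \<epsilon> \<and>
     (\<forall>i. linear_map R (E i) (E (Suc i)) (d i)) \<and>
     inj_on \<epsilon> (carrier M) \<and>
     \<epsilon> ` carrier M = {x \<in> carrier (E 0). d 0 x = \<zero>\<^bsub>E 1\<^esub>} \<and>
     (\<forall>i. d i ` carrier (E i) = {x \<in> carrier (E (Suc i)). d (Suc i) x = \<zero>\<^bsub>E (Suc (Suc i))\<^esub>})"

primrec ideal_pow :: "('a, 'r) ring_scheme \<Rightarrow> 'a set \<Rightarrow> nat \<Rightarrow> 'a set" where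
  "ideal_pow R I 0 = carrier R"
| "ideal_pow R I (Suc k) = ideal_prod R I (ideal_pow R I k)"

text \<open>The \<open>I\<close>-torsion functor on objects; on morphisms it is restriction.\<close>
definition torsion :: "('a, 'r) ring_scheme \<Rightarrow> 'a set \<Rightarrow> ('a, 'b) module \<Rightarrow> 'b set" where
  "torsion R I M =
     {x \<in> carrier M. \<exists>k. \<forall>a\<in>ideal_pow R I k. a \<odot>\<^bsub>M\<^esub> x = \<zero>\<^bsub>M\<^esub>}"

definition quotient_module :: "('a, 'b) module \<Rightarrow> 'b set \<Rightarrow> ('a, 'b set) module" where
  "quotient_module M N =
     \<lparr>carrier = a_rcosets\<^bsub>M\<^esub> N, mult = undefined, one = undefined,
      zero = N, add = set_add M,
      smult = (\<lambda>a X. \<Union>x\<in>X. N +>\<^bsub>M\<^esub> (a \<odot>\<^bsub>M\<^esub> x))\<rparr>"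

definition torsion_cocycles ::
    "('a, 'r) ring_scheme \<Rightarrow> 'a set \<Rightarrow> (nat \<Rightarrow> ('a, 'b) module) \<Rightarrow> (nat \<Rightarrow> 'b \<Rightarrow> 'b) \<Rightarrow>
     nat \<Rightarrow> 'b set" where
  "torsion_cocycles R I E d i = {x \<in> torsion R I (E i). d i x = \<zero>\<^bsub>E (Suc i)\<^esub>}"

definition torsion_coboundaries ::
    "('a, 'r) ring_scheme \<Rightarrow> 'a set \<Rightarrow> (nat \<Rightarrow> ('a, 'b) module) \<Rightarrow> (nat \<Rightarrow> 'b \<Rightarrow> 'b) \<Rightarrow>
     nat \<Rightarrow> 'b set" where
  "torsion_coboundaries R I E d i =
     (case i of 0 \<Rightarrow> {\<zero>\<^bsub>E 0\<^esub>} | Suc j \<Rightarrow> d j ` torsion R I (E j))"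

text \<open>
  The \<open>i\<close>-th right derived functor of the \<open>I\<close>-torsion functor, computed on an injective
  resolution \<open>(E, d)\<close> of the module in question; up to isomorphism it does not depend on the
  resolution.
\<close>
definition local_cohomology ::
    "('a, 'r) ring_scheme \<Rightarrow> 'a set \<Rightarrow> (nat \<Rightarrow> ('a, 'b) module) \<Rightarrow> (nat \<Rightarrow> 'b \<Rightarrow> 'b) \<Rightarrow>
     nat \<Rightarrow> ('a, 'b set) module" where
  "local_cohomology R I E d i =
     quotient_module ((E i)\<lparr>carrier := torsion_cocycles R I E d i\<rparr>)
       (torsion_coboundaries R I E d i)"

definition annihilates :: "'a set \<Rightarrow> ('a, 'b) module \<Rightarrow> bool" where
  "annihilates J M \<longleftrightarrow> (\<forall>a\<in>J. \<forall>x\<in>carrier M. a \<odot>\<^bsub>M\<^esub> x = \<zero>\<^bsub>M\<^esub>)"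

definition self_module :: "('a, 'r) ring_scheme \<Rightarrow> ('a, 'a) module" where
  "self_module R =
     \<lparr>carrier = carrier R, mult = mult R, one = one R, zero = zero R, add = add R,
      smult = mult R\<rparr>"

text \<open>Here \<open>(E, d)\<close> is meant to be an injective resolution of \<open>R\<close> as a module over itself.\<close>
definition strictly_buchsbaum ::
    "nat \<Rightarrow> ('a, 'r) ring_scheme \<Rightarrow> 'a set \<Rightarrow> (nat \<Rightarrow> ('a, 'b) module) \<Rightarrow> (nat \<Rightarrow> 'b \<Rightarrow> 'b) \<Rightarrow> bool" where
  "strictly_buchsbaum k R \<mm> E d \<longleftrightarrow>
     1 \<le> k \<and>
     annihilates (ideal_pow R \<mm> k) (local_cohomology R \<mm> E d 1) \<and>
     \<not> annihilates (ideal_pow R \<mm> (k - 1)) (local_cohomology R \<mm> E d 1)"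

section \<open>The monomial rings\<close>

text \<open>
  \<open>\<K>[s,t]\<close> is the type \<open>nat \<times> nat \<Rightarrow>\<^sub>0 'k\<close> of finitely supported functions on exponent pairs,
  with convolution as multiplication.
\<close>
type_synonym 'k poly2 = "nat \<times> nat \<Rightarrow>\<^sub>0 'k"

definition monom2 :: "nat \<Rightarrow> nat \<Rightarrow> 'k::field poly2" where
  "monom2 i j = Poly_Mapping.single (i, j) 1"

definition const2 :: "'k::field \<Rightarrow> 'k poly2" where
  "const2 c = Poly_Mapping.single (0, 0) c"

definition poly2_ring :: "'k::field poly2 ring" where
  "poly2_ring = \<lparr>carrier = UNIV, mult = (*), one = 1, zero = 0, add = (+)\<rparr>"

definition exp_b1 :: "nat \<Rightarrow> nat" where
  "exp_b1 r = r"

definition exp_b2 :: "nat \<Rightarrow> nat" where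
  "exp_b2 r = 2 * r - 2"

definition exp_a :: "nat \<Rightarrow> nat \<Rightarrow> nat" where
  "exp_a r i = 2 * r + 2 * i - 1"

text \<open>For \<open>r \<ge> 5\<close> none of the subtractions of natural numbers truncates.\<close>
definition monomial_gens :: "nat \<Rightarrow> nat \<Rightarrow> 'k::field poly2 set" where
  "monomial_gens n r =
     {monom2 (exp_a r n) 0,
      monom2 (exp_a r n - exp_b1 r) (exp_b1 r),
      monom2 (exp_a r n - exp_b2 r) (exp_b2 r)} \<union>
     {monom2 (exp_a r n - exp_a r i) (exp_a r i) | i. i < n} \<union>
     {monom2 0 (exp_a r n)}"

text \<open>The \<open>\<K>\<close>-subalgebra generated by a set is the subring generated by it and the constants.\<close>
definition monomial_ring :: "nat \<Rightarrow> nat \<Rightarrow> 'k::field poly2 ring" where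
  "monomial_ring n r =
     poly2_ring\<lparr>carrier := generate_ring poly2_ring (range const2 \<union> monomial_gens n r)\<rparr>"

definition hom_max_ideal :: "nat \<Rightarrow> nat \<Rightarrow> 'k::field poly2 set" where
  "hom_max_ideal n r = genideal (monomial_ring n r) (monomial_gens n r)"

end

theory Submission
  imports Defs
begin

text \<open>
  Write \<open>D\<close> for the common degree of the generators, \<open>X = s\<^sup>D\<close> and \<open>Y = t\<^sup>D\<close>. An injective
  resolution identifies the first local cohomology of \<open>R\<close> with the linear maps from powers of
  \<open>\<mm>\<close> to \<open>R\<close>, modulo multiplications by elements of \<open>R\<close> (\<open>annihilates_H1_iff\<close>). As \<open>\<mm>\<close> contains
  powers of \<open>s\<close> and of \<open>t\<close>, each such map is multiplication by a polynomial \<open>g\<close>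
  (\<open>linear_map_fraction\<close>) with \<open>X\<^sup>k g\<close> and \<open>Y\<^sup>k g\<close> in \<open>R\<close>. Everything is spanned by monomials, so the
  question becomes one about the semigroup \<open>S\<close> of exponents and its saturation \<open>S'\<close>, the exponents that
  enter \<open>S\<close> after adding multiples of \<open>(D, 0)\<close> and of \<open>(0, D)\<close>.

  For \<open>r = 2 * n + 8\<close> a pair in \<open>S'\<close> but not in \<open>S\<close> has degree \<open>2\<close> or \<open>3\<close>, in units of \<open>D\<close>
  (\<open>sum_of_gens_if_saturated\<close>). Adding an element of \<open>S\<close> of degree at least \<open>2\<close> therefore always leads
  into \<open>S\<close> (\<open>exponents_absorb\<close>), whence \<open>\<mm>\<^sup>2\<close> annihilates the cohomology. On the other hand,
  \<open>(2 * D - 3 * r, 3 * r)\<close> lies in \<open>S'\<close>, and adding \<open>(0, D)\<close> to it gives a pair of degree \<open>3\<close> outside \<open>S\<close>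
  (\<open>not_sum_of_three_gens\<close>); so \<open>Y\<close>, which lies in \<open>\<mm>\<close>, does not annihilate the class of that monomial.

  The semigroup statement rests on parity. The odd \<open>t\<close>-exponents of the generators fill an interval of
  odd numbers that ends at \<open>D\<close>, so their \<open>j\<close>-fold sums fill an interval in one parity class. Even
  \<open>t\<close>-exponents can mostly be traded for odd ones (\<open>few_even_gens\<close>), and the \<open>s\<close>-exponents generate
  \<open>\<langle>2, 2 * n + 1\<rangle>\<close>, which in the wrong parity class lowers the bound on the \<open>t\<close>-exponent by
  just the amount that one even exponent cannot make up.
\<close>

section \<open>Sums of exponents\<close>

text \<open>
  For \<open>r = 2 * n + 8\<close> the exponents of \<open>t\<close> in the generators are \<open>0\<close>, the two even numbers
  \<open>r = 2 * n + 8\<close> and \<open>2 * r - 2 = 4 * n + 14\<close>, and all odd numbers from \<open>2 * r - 1 = 4 * n + 15\<close>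
  to the common degree \<open>6 * n + 15\<close>. The sums of exactly \<open>j\<close> of those odd numbers form the
  arithmetic progression \<open>j * (4 * n + 15) + 2 * i\<close> with \<open>i \<le> j * n\<close>, so four numbers describe a
  sum of \<open>m\<close> exponents; the exponent \<open>0\<close> makes it enough to have at most \<open>m\<close> others.
\<close>
definition sum_of_gens :: "nat \<Rightarrow> nat \<Rightarrow> nat \<Rightarrow> bool" where
  "sum_of_gens n m q \<longleftrightarrow>
     (\<exists>c f j i. c + f + j \<le> m \<and> i \<le> j * n \<and>
        q = c * (2 * n + 8) + f * (4 * n + 14) + j * (4 * n + 15) + 2 * i)"

lemma sum_of_gensI:
  "c + f + j \<le> m \<Longrightarrow> i \<le> j * n \<Longrightarrow>
     q = c * (2 * n + 8) + f * (4 * n + 14) + j * (4 * n + 15) + 2 * i \<Longrightarrow> sum_of_gens n m q"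
  unfolding sum_of_gens_def by blast

lemma sum_of_gens_add:
  assumes "sum_of_gens n m q" "sum_of_gens n m' q'"
  shows "sum_of_gens n (m + m') (q + q')"
proof -
  obtain c f j i where 1: "c + f + j \<le> m" "i \<le> j * n"
      "q = c * (2 * n + 8) + f * (4 * n + 14) + j * (4 * n + 15) + 2 * i"
    using assms(1) unfolding sum_of_gens_def by blast
  obtain c' f' j' i' where 2: "c' + f' + j' \<le> m'" "i' \<le> j' * n"
      "q' = c' * (2 * n + 8) + f' * (4 * n + 14) + j' * (4 * n + 15) + 2 * i'"
    using assms(2) unfolding sum_of_gens_def by blast
  show ?thesis
    by (rule sum_of_gensI[of "c + c'" "f + f'" "j + j'" _ "i + i'"])
      (use 1 2 in \<open>auto simp: algebra_simps\<close>)
qed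

text \<open>
  Even exponents can be traded for odd ones without changing the number of summands: with \<open>r\<close> as
  above, \<open>4r = (2r - 1) + (2r + 1) + 0 + 0\<close>, \<open>r + r + (2r - 2) = (2r - 1) + (2r - 1) + 0\<close>, and
  \<open>5(2r - 2)\<close> is \<open>r\<close> plus four odd exponents. Each trade lowers the number of even summands, so
  few of them remain.
\<close>
lemma few_even_gens:
  fixes n :: nat
  assumes n: "n \<ge> 1" and i: "i \<le> j * n"
    and q: "q = c * (2 * n + 8) + f * (4 * n + 14) + j * (4 * n + 15) + 2 * i"
  shows "\<exists>c f j i. i \<le> j * n \<and>
    q = c * (2 * n + 8) + f * (4 * n + 14) + j * (4 * n + 15) + 2 * i \<and>
    c \<le> 3 \<and> f \<le> 4 \<and> (f \<ge> 1 \<longrightarrow> c \<le> 1)"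
  using i q
proof (induction "c + f" arbitrary: c f j i rule: less_induct)
  case less
  consider (c) "c \<ge> 4" | (f) "f \<ge> 5" | (cf) "c \<ge> 2" "f \<ge> 1" | (ok) "c \<le> 3" "f \<le> 4" "f \<ge> 1 \<longrightarrow> c \<le> 1"
    by linarith
  then show ?case
  proof cases
    case c
    then obtain c0 where c0: "c = c0 + 4" by (metis add.commute le_Suc_ex)
    show ?thesis
      by (rule less.hyps[of c0 f "i + 1" "j + 2"])
        (use less.prems n c0 in \<open>auto simp: algebra_simps\<close>)
  next
    case f
    then obtain f0 where f0: "f = f0 + 5" by (metis add.commute le_Suc_ex)
    show ?thesis
      by (rule less.hyps[of "c + 1" f0 "i + n + 1" "j + 4"])
        (use less.prems n f0 in \<open>auto simp: algebra_simps\<close>)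
  next
    case cf
    then have "c = (c - 2) + 2" "f = (f - 1) + 1" by auto
    then obtain c0 f0 where "c = c0 + 2" "f = f0 + 1" by blast
    then show ?thesis
      by (intro less.hyps[of c0 f0 i "j + 2"])
        (use less.prems n in \<open>auto simp: algebra_simps\<close>)
  next
    case ok
    then show ?thesis using less.prems by blast
  qed
qed

text \<open>
  The \<open>s\<close>-exponents complementary to \<open>0\<close>, \<open>r\<close>, \<open>2r - 2\<close> and to the odd numbers are
  \<open>6 * n + 15\<close>, \<open>4 * n + 7\<close>, \<open>2 * n + 1\<close> and \<open>0, 2, ..., 2 * n\<close>.
\<close>
lemma exponent_decomposition:
  fixes n m p q :: nat
  assumes "sum_of_gens n m q" "p + q = m * (6 * n + 15)"
  obtains u c f j i v where "i + v = j * n"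
    "p = u * (6 * n + 15) + c * (4 * n + 7) + f * (2 * n + 1) + 2 * v"
    "q = c * (2 * n + 8) + f * (4 * n + 14) + j * (4 * n + 15) + 2 * i"
proof -
  obtain c f j i where 1: "c + f + j \<le> m" "i \<le> j * n"
      "q = c * (2 * n + 8) + f * (4 * n + 14) + j * (4 * n + 15) + 2 * i"
    using assms(1) unfolding sum_of_gens_def by blast
  obtain u where m: "m = c + f + j + u" using le_Suc_ex[OF 1(1)] by blast
  obtain v where v: "j * n = i + v" using le_Suc_ex[OF 1(2)] by blast
  have "p = u * (6 * n + 15) + c * (4 * n + 7) + f * (2 * n + 1) + 2 * v"
    using assms(2) v unfolding 1(3) m by (simp add: algebra_simps)
  then show ?thesis using 1(3) v by (intro that) simp_all
qed

text \<open>
  The \<open>s\<close>-exponents of the generators generate the numerical semigroup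
  \<open>\<langle>2, 2 * n + 1\<rangle>\<close>, whose gaps are the odd numbers below \<open>2 * n + 1\<close>.
\<close>
lemma complementary_gaps:
  fixes n m p q :: nat
  assumes "sum_of_gens n m q" "p + q = m * (6 * n + 15)"
  shows "even p \<or> p \<ge> 2 * n + 1"
proof -
  obtain u c f v where p: "p = u * (6 * n + 15) + c * (4 * n + 7) + f * (2 * n + 1) + 2 * v"
    using exponent_decomposition[OF assms] by metis
  show ?thesis
  proof (cases "u = 0 \<and> c = 0 \<and> f = 0")
    case True
    then show ?thesis using p by simp
  next
    case False
    then consider "u \<ge> 1" | "c \<ge> 1" | "f \<ge> 1" by linarith
    then have "p \<ge> 2 * n + 1"
    proof cases
      case 1 then show ?thesis by (cases u) (simp_all add: p)
    next
      case 2 then show ?thesis by (cases c) (simp_all add: p)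
    next
      case 3 then show ?thesis by (cases f) (simp_all add: p)
    qed
    then show ?thesis ..
  qed
qed

lemma odd_block:
  fixes x j n :: nat
  assumes "x \<ge> j * (4 * n + 15)" "x \<le> j * (6 * n + 15)" "even (x + j)"
  obtains i where "i \<le> j * n" "x = j * (4 * n + 15) + 2 * i"
proof -
  obtain y where y: "x = j * (4 * n + 15) + y" using le_Suc_ex[OF assms(1)] by blast
  have "even y" using assms(3) y by simp presburger
  then obtain i where "y = 2 * i" by blast
  moreover from this have "i \<le> j * n" using assms(2) y by (simp add: algebra_simps)
  ultimately show ?thesis using y that by blast
qed

text \<open>
  If \<open>p\<close> is even then \<open>q\<close> has the parity of \<open>m\<close>, and \<open>m\<close> odd exponents reach it as soon as
  \<open>q \<ge> m * (4 * n + 15)\<close>. A smaller \<open>q\<close> uses \<open>j \<le> m - 2\<close> odd exponents in the given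
  representation, and its few even summands fit into the remaining \<open>m - j\<close> places. The one exception
  is \<open>3r\<close> on top of \<open>m - 2\<close> odd exponents, which has to be rewritten.
\<close>
lemma sum_of_gens_if_even_codegree:
  fixes n m p q c f j i :: nat
  assumes n: "n \<ge> 1" and m: "m \<ge> 4" and pq: "p + q = m * (6 * n + 15)" and ev: "even p"
    and q: "q = c * (2 * n + 8) + f * (4 * n + 14) + j * (4 * n + 15) + 2 * i"
    and i: "i \<le> j * n" and c: "c \<le> 3" and f: "f \<le> 4" and cf: "f \<ge> 1 \<Longrightarrow> c \<le> 1"
  shows "sum_of_gens n m q"
proof (cases "q \<ge> m * (4 * n + 15)")
  case True
  have "even (p + q) \<longleftrightarrow> even m" unfolding pq by simp
  then have "even (q + m)" using ev by simp
  then obtain i' where "i' \<le> m * n" "q = m * (4 * n + 15) + 2 * i'"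
    using odd_block[of m n q] True pq by (metis le_add2)
  then show ?thesis by (intro sum_of_gensI[of 0 0 m m i']) auto
next
  case False
  have "j * (4 * n + 15) < m * (4 * n + 15)" using False q by linarith
  then have jm: "j < m" by simp
  have "even (p + q) \<longleftrightarrow> even m" unfolding pq by simp
  then have "even j \<longleftrightarrow> even m" using ev q by simp
  with jm obtain t where "m = j + t" "even t" "t > 0"
    by (metis even_add less_imp_add_positive)
  then obtain s where mj: "m = j + 2 * s" and s: "s \<ge> 1" by (auto elim!: evenE)
  have lt: "c * (2 * n + 8) + f * (4 * n + 14) + 2 * i < 2 * (s * (4 * n + 15))"
    using False q mj by (simp add: algebra_simps)
  consider (short) "c + f + j \<le> m" | (long) "c + f > 2 * s" using mj by linarith
  then show ?thesis
  proof cases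
    case short then show ?thesis using i q by (intro sum_of_gensI)
  next
    case long
    have "f = 0"
    proof (rule ccontr)
      assume "f \<noteq> 0"
      then have "c \<le> 1" using cf by simp
      have "s \<le> 2" using long \<open>c \<le> 1\<close> f by linarith
      then consider "s = 1" | "s = 2" using s by linarith
      moreover have "f \<in> {0,1,2,3,4}" "c \<in> {0,1}" using f \<open>c \<le> 1\<close> by auto
      ultimately show False using lt long by cases auto
    qed
    then have c3: "c = 3" and "s = 1" using long c s by auto
    then have m2: "m = j + 2" "j \<ge> 2" using mj m by auto
    show ?thesis
    proof (cases "i < j * n")
      case True
      \<comment> \<open>\<open>3r = r + (2r - 2) + 2\<close>\<close>
      then show ?thesis
        by (intro sum_of_gensI[of 1 1 j m "i + 1"]) (auto simp: m2 q \<open>f = 0\<close> c3)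
    next
      case ij: False
      then have i': "i = j * n" using i by simp
      show ?thesis
        \<comment> \<open>Here \<open>3r\<close> becomes two summands \<open>2r - 2\<close>, at the expense of \<open>r - 4\<close> in the odd part.
            Only for \<open>n = 1\<close> and \<open>j = 2\<close> is the odd part too short: \<open>3 \<cdot> 10 + 2 \<cdot> 21 = 4 \<cdot> 18\<close>.\<close>
      proof (cases "n = 1 \<and> j = 2")
        case True
        then show ?thesis
          by (intro sum_of_gensI[of 0 4 0 m 0]) (auto simp: m2 q \<open>f = 0\<close> c3 i')
      next
        case nj: False
        have "n + 2 \<le> j * n"
        proof (cases "n = 1")
          case False
          then have "n + 2 \<le> 2 * n" using n by simp
          also have "\<dots> \<le> j * n" using m2 by (intro mult_right_mono) auto
          finally show ?thesis .
        qed (use nj m2 in auto)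
        then obtain w where w: "j * n = n + 2 + w" using le_Suc_ex by blast
        show ?thesis
          by (intro sum_of_gensI[of 0 2 j m w]) (auto simp: m2 q \<open>f = 0\<close> c3 i' w)
      qed
    qed
  qed
qed

text \<open>
  If \<open>p\<close> is odd then \<open>q\<close> has the parity of \<open>k = m - 1\<close>, and the bound on \<open>p\<close> says that \<open>q\<close> does not
  exceed the largest sum of \<open>k\<close> odd exponents and \<open>2r - 2\<close>. The sums of \<open>k\<close> odd exponents and one of
  \<open>0\<close>, \<open>r\<close>, \<open>2r - 2\<close> fill three intervals; since \<open>k \<ge> 3\<close>, these leave no hole in the parity class
  except a single number for \<open>n = 1\<close>, and smaller \<open>q\<close> are handled as in the even case.
\<close>
lemma sum_of_gens_if_odd_codegree:
  fixes n m p q c f j i :: nat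
  assumes n: "n \<ge> 1" and m: "m \<ge> 4" and pq: "p + q = m * (6 * n + 15)"
    and od: "odd p" and p: "p \<ge> 2 * n + 1"
    and q: "q = c * (2 * n + 8) + f * (4 * n + 14) + j * (4 * n + 15) + 2 * i"
    and i: "i \<le> j * n" and c: "c \<le> 3" and f: "f \<le> 4" and cf: "f \<ge> 1 \<Longrightarrow> c \<le> 1"
  shows "sum_of_gens n m q"
proof -
  obtain k where k: "m = k + 1" "k \<ge> 3" using m that[of "m - 1"] by simp
  have "even (p + q) \<longleftrightarrow> even m" unfolding pq by simp
  then have par: "even (q + k)" using od k by simp
  have jk: "even j \<longleftrightarrow> even k" using par q by simp
  have upper: "q \<le> k * (6 * n + 15) + (4 * n + 14)" using pq p k by simp
  show ?thesis
  proof (cases "q < k * (4 * n + 15)")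
    case True
    have "j * (4 * n + 15) < k * (4 * n + 15)" using True q by linarith
    then have "j < k" by simp
    with jk obtain t where "k = j + t" "even t" "t > 0"
      by (metis even_add less_imp_add_positive)
    then obtain s where kj: "k = j + 2 * s" and s: "s \<ge> 1" by (auto elim!: evenE)
    have lt: "c * (2 * n + 8) + f * (4 * n + 14) + 2 * i < 2 * (s * (4 * n + 15))"
      using True q kj by (simp add: algebra_simps)
    have "c + f \<le> 2 * s + 1"
    proof (rule ccontr)
      assume long: "\<not> ?thesis"
      then have "f \<ge> 1" using c s by linarith
      then have "c \<le> 1" using cf by simp
      have "s = 1" using long \<open>c \<le> 1\<close> f s by linarith
      moreover have "f \<in> {0,1,2,3,4}" "c \<in> {0,1}" using f \<open>c \<le> 1\<close> by auto
      ultimately show False using lt long by auto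
    qed
    then show ?thesis using i q k kj by (intro sum_of_gensI[of c f j m i]) auto
  next
    case False
    have width: "k * (6 * n + 15) = k * (4 * n + 15) + 2 * (k * n)" by (simp add: algebra_simps)
    have kn: "k * n \<ge> 3 * n" using k by (intro mult_right_mono) auto
    consider (zero) "q \<le> k * (6 * n + 15)"
      | (hole) "k * (6 * n + 15) < q" "q < k * (4 * n + 15) + (2 * n + 8)"
      | (one) "k * (4 * n + 15) + (2 * n + 8) \<le> q" "q \<le> k * (6 * n + 15) + (2 * n + 8)"
      | (two) "k * (4 * n + 15) + (4 * n + 14) \<le> q"
      | (none) "k * (6 * n + 15) + (2 * n + 8) < q" "q < k * (4 * n + 15) + (4 * n + 14)"
      by linarith
    then show ?thesis
    proof cases
      case zero
      then obtain i' where "i' \<le> k * n" "q = k * (4 * n + 15) + 2 * i'"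
        using odd_block[of k n q] False par by auto
      then show ?thesis using k by (intro sum_of_gensI[of 0 0 k m i']) auto
    next
      case one
      then obtain x where x: "q = x + (2 * n + 8)" by (metis add.commute add_leD2 le_Suc_ex)
      then obtain i' where "i' \<le> k * n" "x = k * (4 * n + 15) + 2 * i'"
        using odd_block[of k n x] one par by auto
      then show ?thesis using k x by (intro sum_of_gensI[of 1 0 k m i']) auto
    next
      case two
      then obtain x where x: "q = x + (4 * n + 14)" by (metis add.commute add_leD2 le_Suc_ex)
      then obtain i' where "i' \<le> k * n" "x = k * (4 * n + 15) + 2 * i'"
        using odd_block[of k n x] two par upper by auto
      then show ?thesis using k x by (intro sum_of_gensI[of 0 1 k m i']) auto
    next
      case none
      have "2 * (k * n) < 2 * n + 6" using none width by linarith
      moreover have "2 * (k * n) \<ge> 6 * n" using kn by linarith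
      moreover have "even q \<longleftrightarrow> even k" using par by simp
      ultimately have "n = 1" using n by linarith
      then have "k = 3" using \<open>2 * (k * n) < 2 * n + 6\<close> k by simp
      with none \<open>n = 1\<close> have "q > 73" "q < 75" by auto
      then have "q = 74" by linarith
      with par \<open>k = 3\<close> show ?thesis by simp
    next
      \<comment> \<open>This leaves \<open>n = 1\<close> and \<open>q = 65\<close>, which lies in the semigroup as \<open>19 + 10 + 18 + 18\<close>.\<close>
      case hole
      have "2 * (k * n) < 2 * n + 8" using hole width by linarith
      then have "n = 1" using n kn by linarith
      then have k3: "k = 3 \<or> k = 4" using \<open>2 * (k * n) < 2 * n + 8\<close> k by auto
      have "k \<noteq> 4"
      proof
        assume "k = 4"
        with hole \<open>n = 1\<close> have "q > 84" "q < 86" by auto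
        then have "q = 85" by linarith
        with par \<open>k = 4\<close> show False by simp
      qed
      with k3 have "k = 3" by simp
      with hole \<open>n = 1\<close> have qq: "q > 63" "q < 67" by auto
      have "odd j" using jk \<open>k = 3\<close> by simp
      have "j \<le> 3" using q \<open>n = 1\<close> qq by simp
      then have "j = 1 \<or> j = 3" using \<open>odd j\<close> by presburger
      then show ?thesis
      proof
        assume "j = 3"
        then have "i \<le> 3" "c = 0" "f = 0" using i q qq \<open>n = 1\<close> by auto
        then show ?thesis using q qq \<open>n = 1\<close> \<open>j = 3\<close> by auto
      next
        assume "j = 1"
        have "c + f \<le> 3"
        proof (rule ccontr)
          assume "\<not> ?thesis"
          then have "f = 3 \<or> f = 4" "c \<le> 1" using c cf f by auto
          then show False using q qq \<open>n = 1\<close> \<open>j = 1\<close> \<open>\<not> c + f \<le> 3\<close> by auto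
        qed
        then show ?thesis using q i k \<open>k = 3\<close> \<open>j = 1\<close>
          by (intro sum_of_gensI[of c f j m i]) auto
      qed
    qed
  qed
qed

text \<open>In degree \<open>1\<close> the bounds on \<open>p\<close> and on \<open>q\<close> leave no room for two positive exponents.\<close>
lemma sum_of_gens_if_degree_le_one:
  fixes n m p q c f j i :: nat
  assumes m: "m \<le> 1" and pq: "p + q = m * (6 * n + 15)" and p: "even p \<or> p \<ge> 2 * n + 1"
    and q: "q = c * (2 * n + 8) + f * (4 * n + 14) + j * (4 * n + 15) + 2 * i"
    and i: "i \<le> j * n"
  shows "sum_of_gens n m q"
proof (cases "m = 0")
  case True
  then show ?thesis using pq by (intro sum_of_gensI[of 0 0 0 m 0]) auto
next
  case False
  then have m1: "m = 1" using m by simp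
  have "c + f + j \<le> 1"
  proof (rule ccontr)
    assume long: "\<not> ?thesis"
    have le: "q \<le> 6 * n + 15" using pq m1 by simp
    have j: "j \<le> 1"
    proof (rule ccontr)
      assume "\<not> j \<le> 1"
      then have "2 \<le> j" by simp
      then obtain x where "j = 2 + x" using le_Suc_ex by blast
      then show False using le q by simp
    qed
    have f: "f \<le> 1"
    proof (rule ccontr)
      assume "\<not> f \<le> 1"
      then have "2 \<le> f" by simp
      then obtain x where "f = 2 + x" using le_Suc_ex by blast
      then show False using le q by simp
    qed
    have c: "c \<le> 2"
    proof (rule ccontr)
      assume "\<not> c \<le> 2"
      then have "3 \<le> c" by simp
      then obtain x where "c = 3 + x" using le_Suc_ex by blast
      then show False using le q by (simp add: algebra_simps)
    qed
    have "even (p + q) \<longleftrightarrow> False" unfolding pq m1 by simp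
    then have pj: "even p \<longleftrightarrow> odd j" using q by simp
    have "c = 0 \<or> c = 1 \<or> c = 2" "f = 0 \<or> f = 1" "j = 0 \<or> j = 1" using c f j by auto
    then show False using long q le pj p pq m1 by auto
  qed
  then show ?thesis using m1 i q by (intro sum_of_gensI) auto
qed

text \<open>
  The hypotheses say that the monomial of degree \<open>m\<close> with exponents \<open>(p, q)\<close> enters the ring after
  multiplication by a power of \<open>s\<close>, and also by a power of \<open>t\<close>. The semigroup of exponents is thus
  saturated in this sense outside degrees \<open>2\<close> and \<open>3\<close>.
\<close>
lemma sum_of_gens_if_saturated:
  assumes n: "n \<ge> 1" and pq: "p + q = m * (6 * n + 15)" and "sum_of_gens n m' q"
    and "sum_of_gens n m'' Q" "p + Q = m'' * (6 * n + 15)"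
    and m: "m \<noteq> 2" "m \<noteq> 3"
  shows "sum_of_gens n m q"
proof -
  obtain c f j i where "i \<le> j * n"
      "q = c * (2 * n + 8) + f * (4 * n + 14) + j * (4 * n + 15) + 2 * i"
    using assms(3) unfolding sum_of_gens_def by blast
  then obtain c f j i where *: "i \<le> j * n"
    "q = c * (2 * n + 8) + f * (4 * n + 14) + j * (4 * n + 15) + 2 * i"
    "c \<le> 3" "f \<le> 4" "f \<ge> 1 \<Longrightarrow> c \<le> 1"
    using few_even_gens[OF n] by meson
  have gap: "even p \<or> p \<ge> 2 * n + 1" using complementary_gaps assms(4,5) .
  consider "m \<le> 1" | "m \<ge> 4" "even p" | "m \<ge> 4" "odd p" using m by linarith
  then show ?thesis
  proof cases
    case 1 then show ?thesis using sum_of_gens_if_degree_le_one pq gap *(1,2) by blast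
  next
    case 2 then show ?thesis using sum_of_gens_if_even_codegree[OF n _ pq _ *(2,1,3,4,5)] by blast
  next
    case 3 then show ?thesis using sum_of_gens_if_odd_codegree[OF n _ pq _ _ *(2,1,3,4,5)] gap by blast
  qed
qed

text \<open>
  The number is \<open>3r\<close> plus the largest exponent. By parity one or three summands are odd; three odd
  ones are too large together, and one odd summand leaves a difference that two even exponents miss.
\<close>
lemma not_sum_of_three_gens: "\<not> sum_of_gens n 3 (12 * n + 39)"
proof
  assume "sum_of_gens n 3 (12 * n + 39)"
  then obtain c f j i where 1: "c + f + j \<le> 3" "i \<le> j * n"
      and q: "12 * n + 39 = c * (2 * n + 8) + f * (4 * n + 14) + j * (4 * n + 15) + 2 * i"
    unfolding sum_of_gens_def by blast
  have "odd (12 * n + 39)" by simp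
  then have "odd j" unfolding q by simp
  moreover have "j \<le> 3" using 1(1) by simp
  ultimately have "j = 1 \<or> j = 3" by presburger
  moreover have "c \<in> {0,1,2,3}" "f \<in> {0,1,2,3}" using 1(1) by auto
  ultimately show False using 1 q by auto
qed

section \<open>First local cohomology and linear maps on powers of an ideal\<close>

context cring
begin

lemma ideal_pow_ideal:
  assumes "ideal I R" shows "ideal (ideal_pow R I k) R"
  by (induction k) (use assms oneideal ideal_prod_is_ideal in auto)

lemma ideal_pow_antimono:
  assumes "ideal I R" "k \<le> l" shows "ideal_pow R I l \<subseteq> ideal_pow R I k"
  using assms(2)
proof (induction rule: dec_induct)
  case (step l)
  have "ideal_pow R I (Suc l) \<subseteq> ideal_pow R I l"
    using ideal_prod_inter[OF assms(1) ideal_pow_ideal[OF assms(1)]] by auto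
  with step show ?case by blast
qed simp

end

lemma linear_map_simps:
  assumes "linear_map R M N f"
  shows "x \<in> carrier M \<Longrightarrow> f x \<in> carrier N"
    and "x \<in> carrier M \<Longrightarrow> y \<in> carrier M \<Longrightarrow> f (x \<oplus>\<^bsub>M\<^esub> y) = f x \<oplus>\<^bsub>N\<^esub> f y"
    and "a \<in> carrier R \<Longrightarrow> x \<in> carrier M \<Longrightarrow> f (a \<odot>\<^bsub>M\<^esub> x) = a \<odot>\<^bsub>N\<^esub> f x"
  using assms unfolding linear_map_def by auto

lemma linear_map_zero:
  assumes "module R M" "module R N" "linear_map R M N f"
  shows "f \<zero>\<^bsub>M\<^esub> = \<zero>\<^bsub>N\<^esub>"
proof -
  interpret M: module R M by fact
  interpret N: module R N by fact
  have "f \<zero>\<^bsub>M\<^esub> = f (\<zero>\<^bsub>R\<^esub> \<odot>\<^bsub>M\<^esub> \<zero>\<^bsub>M\<^esub>)" by simp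
  also have "\<dots> = \<zero>\<^bsub>R\<^esub> \<odot>\<^bsub>N\<^esub> f \<zero>\<^bsub>M\<^esub>" by (rule linear_map_simps(3)[OF assms(3)]) simp_all
  also have "\<dots> = \<zero>\<^bsub>N\<^esub>" using linear_map_simps(1)[OF assms(3)] by simp
  finally show ?thesis .
qed

lemma linear_map_minus:
  assumes "module R M" "module R N" "linear_map R M N f" "x \<in> carrier M"
  shows "f (\<ominus>\<^bsub>M\<^esub> x) = \<ominus>\<^bsub>N\<^esub> f x"
proof -
  interpret M: module R M by fact
  interpret N: module R N by fact
  have "f (\<ominus>\<^bsub>M\<^esub> x) \<oplus>\<^bsub>N\<^esub> f x = f (\<ominus>\<^bsub>M\<^esub> x \<oplus>\<^bsub>M\<^esub> x)"
    using linear_map_simps[OF assms(3)] assms(4) by simp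
  also have "\<dots> = \<zero>\<^bsub>N\<^esub>"
    using linear_map_zero[OF assms(1-3)] assms(4) by (simp add: M.M.l_neg)
  finally show ?thesis
    using linear_map_simps[OF assms(3)] assms(4) by (simp add: N.M.minus_equality)
qed

lemma submodule_linear_image:
  assumes "module R M" "module R N" "linear_map R M N f" "submodule H R M"
  shows "submodule (f ` H) R N"
proof -
  interpret M: module R M by fact
  interpret N: module R N by fact
  note H = M.submoduleE[OF assms(4)]
  have zero: "\<zero>\<^bsub>M\<^esub> \<in> H" using assms(4) unfolding submodule_def subgroup_def by simp
  note f = linear_map_simps[OF assms(3)]
  show ?thesis
  proof (rule N.submoduleI)
    show "f ` H \<subseteq> carrier N" using H(1) f by auto
    show "\<zero>\<^bsub>N\<^esub> \<in> f ` H" using zero linear_map_zero[OF assms(1-3)] by (metis imageI)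
  next
    fix a assume "a \<in> f ` H"
    then obtain h where h: "h \<in> H" "a = f h" by blast
    then have "\<ominus>\<^bsub>N\<^esub> a = f (\<ominus>\<^bsub>M\<^esub> h)" using linear_map_minus[OF assms(1-3)] H(1) by (metis subsetD)
    then show "\<ominus>\<^bsub>N\<^esub> a \<in> f ` H" using h H(3) by blast
  next
    fix a b assume "a \<in> f ` H" "b \<in> f ` H"
    then obtain h k where h: "h \<in> H" "a = f h" "k \<in> H" "b = f k" by blast
    then have "a \<oplus>\<^bsub>N\<^esub> b = f (h \<oplus>\<^bsub>M\<^esub> k)" using f H(1) by (metis subsetD)
    then show "a \<oplus>\<^bsub>N\<^esub> b \<in> f ` H" using h H(5) by blast
  next
    fix a x assume "a \<in> carrier R" "x \<in> f ` H"
    then obtain h where h: "h \<in> H" "x = f h" by blast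
    then have "a \<odot>\<^bsub>N\<^esub> x = f (a \<odot>\<^bsub>M\<^esub> h)" using f H(1) \<open>a \<in> carrier R\<close> by (metis subsetD)
    then show "a \<odot>\<^bsub>N\<^esub> x \<in> f ` H" using h H(4) \<open>a \<in> carrier R\<close> by blast
  qed
qed

lemma submodule_torsion:
  assumes "module R M" "ideal I R"
  shows "submodule (torsion R I M) R M"
proof -
  interpret M: module R M by fact
  have pw: "a \<in> carrier R" if "a \<in> ideal_pow R I k" for a k
    using ideal.Icarr[OF M.ideal_pow_ideal[OF assms(2)] that] .
  show ?thesis
  proof (rule M.submoduleI)
    show "torsion R I M \<subseteq> carrier M" unfolding torsion_def by auto
    show "\<zero>\<^bsub>M\<^esub> \<in> torsion R I M" unfolding torsion_def using pw by auto
  next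
    fix a assume "a \<in> torsion R I M"
    then obtain k where "a \<in> carrier M" "\<And>u. u \<in> ideal_pow R I k \<Longrightarrow> u \<odot>\<^bsub>M\<^esub> a = \<zero>\<^bsub>M\<^esub>"
      unfolding torsion_def by blast
    then show "\<ominus>\<^bsub>M\<^esub> a \<in> torsion R I M"
      unfolding torsion_def using pw by (auto simp: M.smult_r_minus intro!: exI[of _ k])
  next
    fix a b assume "a \<in> torsion R I M" "b \<in> torsion R I M"
    then obtain k l where *: "a \<in> carrier M" "\<And>u. u \<in> ideal_pow R I k \<Longrightarrow> u \<odot>\<^bsub>M\<^esub> a = \<zero>\<^bsub>M\<^esub>"
        "b \<in> carrier M" "\<And>u. u \<in> ideal_pow R I l \<Longrightarrow> u \<odot>\<^bsub>M\<^esub> b = \<zero>\<^bsub>M\<^esub>"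
      unfolding torsion_def by blast
    have "u \<odot>\<^bsub>M\<^esub> (a \<oplus>\<^bsub>M\<^esub> b) = \<zero>\<^bsub>M\<^esub>" if "u \<in> ideal_pow R I (max k l)" for u
      using that * pw M.ideal_pow_antimono[OF assms(2), of k "max k l"]
        M.ideal_pow_antimono[OF assms(2), of l "max k l"]
      by (simp add: M.smult_r_distr subset_iff)
    then show "a \<oplus>\<^bsub>M\<^esub> b \<in> torsion R I M" unfolding torsion_def using * by blast
  next
    fix a x assume a: "a \<in> carrier R" and "x \<in> torsion R I M"
    then obtain k where *: "x \<in> carrier M" "\<And>u. u \<in> ideal_pow R I k \<Longrightarrow> u \<odot>\<^bsub>M\<^esub> x = \<zero>\<^bsub>M\<^esub>"
      unfolding torsion_def by blast
    have "u \<odot>\<^bsub>M\<^esub> (a \<odot>\<^bsub>M\<^esub> x) = \<zero>\<^bsub>M\<^esub>" if u: "u \<in> ideal_pow R I k" for u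
    proof -
      have "u \<odot>\<^bsub>M\<^esub> (a \<odot>\<^bsub>M\<^esub> x) = a \<odot>\<^bsub>M\<^esub> (u \<odot>\<^bsub>M\<^esub> x)"
        using a *(1) pw[OF u] by (simp flip: M.smult_assoc1 add: M.R.m_comm)
      then show ?thesis using * u a by simp
    qed
    then show "a \<odot>\<^bsub>M\<^esub> x \<in> torsion R I M" unfolding torsion_def using a * by blast
  qed
qed

lemma linear_map_torsion:
  assumes "module R M" "module R N" "linear_map R M N f" "ideal I R" "x \<in> torsion R I M"
  shows "f x \<in> torsion R I N"
proof -
  interpret M: module R M by fact
  have pw: "a \<in> carrier R" if "a \<in> ideal_pow R I k" for a k
    using ideal.Icarr[OF M.ideal_pow_ideal[OF assms(4)] that] .
  obtain k where *: "x \<in> carrier M" "\<And>u. u \<in> ideal_pow R I k \<Longrightarrow> u \<odot>\<^bsub>M\<^esub> x = \<zero>\<^bsub>M\<^esub>"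
    using assms(5) unfolding torsion_def by blast
  then have "u \<odot>\<^bsub>N\<^esub> f x = \<zero>\<^bsub>N\<^esub>" if "u \<in> ideal_pow R I k" for u
    using linear_map_simps(3)[OF assms(3), of u x] pw[OF that] that linear_map_zero[OF assms(1-3)]
    by simp
  then show ?thesis unfolding torsion_def using linear_map_simps(1)[OF assms(3)] *(1) by blast
qed

text \<open>Scalar multiplication of the coset of \<open>z\<close> by \<open>a\<close> gives the coset of \<open>a z\<close>.\<close>
lemma annihilates_quotient_iff:
  assumes "module R M" and N: "submodule N R M" and "N \<subseteq> Z" and Z: "Z \<subseteq> carrier M"
    and J: "J \<subseteq> carrier R"
  shows "annihilates J (quotient_module (M\<lparr>carrier := Z\<rparr>) N) \<longleftrightarrow>
     (\<forall>a\<in>J. \<forall>z\<in>Z. a \<odot>\<^bsub>M\<^esub> z \<in> N)"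
proof -
  interpret M: module R M by fact
  note N' = M.submoduleE[OF N]
  have sub: "subgroup N (add_monoid M)" using N by (rule submodule.axioms)
  have zero: "\<zero>\<^bsub>M\<^esub> \<in> N" using sub unfolding subgroup_def by simp
  have coset: "N +>\<^bsub>M\<lparr>carrier := Z\<rparr>\<^esub> z = N +>\<^bsub>M\<^esub> z" for z
    unfolding a_r_coset_def' by simp
  have key: "(\<Union>x\<in>N +>\<^bsub>M\<^esub> z. N +>\<^bsub>M\<^esub> (a \<odot>\<^bsub>M\<^esub> x)) = N \<longleftrightarrow> a \<odot>\<^bsub>M\<^esub> z \<in> N"
    if "a \<in> J" "z \<in> Z" for a z
  proof -
    have az: "a \<in> carrier R" "z \<in> carrier M" using that Z J by auto
    have in_coset: "z \<in> N +>\<^bsub>M\<^esub> z" using zero az unfolding a_r_coset_def' by force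
    have eq: "N +>\<^bsub>M\<^esub> (a \<odot>\<^bsub>M\<^esub> x) = N +>\<^bsub>M\<^esub> (a \<odot>\<^bsub>M\<^esub> z)" if x: "x \<in> N +>\<^bsub>M\<^esub> z" for x
    proof -
      obtain b where b: "b \<in> N" "x = b \<oplus>\<^bsub>M\<^esub> z" using x unfolding a_r_coset_def' by blast
      have "a \<odot>\<^bsub>M\<^esub> x = a \<odot>\<^bsub>M\<^esub> b \<oplus>\<^bsub>M\<^esub> a \<odot>\<^bsub>M\<^esub> z"
        using b az N'(1) by (auto simp: M.smult_r_distr)
      then have "a \<odot>\<^bsub>M\<^esub> x \<in> N +>\<^bsub>M\<^esub> (a \<odot>\<^bsub>M\<^esub> z)"
        using b az N'(4) unfolding a_r_coset_def' by auto
      then show ?thesis using M.a_repr_independence[OF _ _ sub] az by (metis M.smult_closed)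
    qed
    have "(\<Union>x\<in>N +>\<^bsub>M\<^esub> z. N +>\<^bsub>M\<^esub> (a \<odot>\<^bsub>M\<^esub> x)) = N +>\<^bsub>M\<^esub> (a \<odot>\<^bsub>M\<^esub> z)"
      using eq in_coset by blast
    also have "\<dots> = N \<longleftrightarrow> a \<odot>\<^bsub>M\<^esub> z \<in> N"
      using M.a_coset_join1[OF _ _ sub] M.a_coset_join2[OF _ sub] az by auto
    finally show ?thesis .
  qed
  have carr: "carrier (quotient_module (M\<lparr>carrier := Z\<rparr>) N) = (\<lambda>z. N +>\<^bsub>M\<^esub> z) ` Z"
    unfolding quotient_module_def A_RCOSETS_def' by (auto simp: coset)
  show ?thesis
    unfolding annihilates_def carr using key
    by (simp add: quotient_module_def a_r_coset_def' )
qed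

lemma submodule_ideal:
  assumes "module R (self_module R)" "ideal J R"
  shows "submodule J R (self_module R)"
proof -
  interpret J: ideal J R by fact
  interpret M: module R "self_module R" by fact
  have "\<ominus>\<^bsub>self_module R\<^esub> x = \<ominus>\<^bsub>R\<^esub> x" for x
    by (simp add: self_module_def a_inv_def m_inv_def)
  then show ?thesis
    by (intro M.submoduleI) (auto simp: self_module_def J.I_l_closed J.Icarr)
qed

text \<open>
  The first local cohomology is the direct limit of \<open>Hom (I\<^sup>k, R)\<close> modulo multiplications by elements
  of \<open>R\<close>. A class is represented by \<open>z = d y\<close> with \<open>y\<close> in \<open>E 0\<close> and \<open>I\<^sup>k y \<subseteq> \<epsilon> R\<close>, which gives the
  map \<open>u \<mapsto> \<epsilon>\<inverse> (u y)\<close> on \<open>I\<^sup>k\<close>; conversely the injectivity of \<open>E 0\<close> extends \<open>\<epsilon> \<circ> \<phi>\<close> from \<open>I\<^sup>k\<close> to \<open>R\<close>,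
  and \<open>y\<close> is the image of \<open>1\<close>. The class of \<open>a z\<close> vanishes iff \<open>a y\<close> agrees with some \<open>\<epsilon> h\<close> up to
  torsion, that is, iff \<open>a \<phi>\<close> is multiplication by \<open>h\<close>; the regular element \<open>x\<close> of \<open>I\<close> removes the
  torsion from such an equation in \<open>R\<close>.
\<close>
theorem annihilates_H1_iff:
  assumes res: "injective_resolution R (self_module R) \<epsilon> E d"
    and I: "ideal I R" and J: "J \<subseteq> carrier R"
    and x: "x \<in> I" and reg: "\<And>y. y \<in> carrier R \<Longrightarrow> x \<otimes>\<^bsub>R\<^esub> y = \<zero>\<^bsub>R\<^esub> \<Longrightarrow> y = \<zero>\<^bsub>R\<^esub>"
  shows "annihilates J (local_cohomology R I E d 1) \<longleftrightarrow>
    (\<forall>k \<phi>. \<forall>a\<in>J. linear_map R (self_module R\<lparr>carrier := ideal_pow R I k\<rparr>) (self_module R) \<phi> \<longrightarrow>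
       (\<exists>h\<in>carrier R. \<forall>u\<in>ideal_pow R I k. a \<otimes>\<^bsub>R\<^esub> \<phi> u = h \<otimes>\<^bsub>R\<^esub> u))"
proof -
  have M: "module R (self_module R)" and inj: "injective_module R (E i)"
    and \<epsilon>: "linear_map R (self_module R) (E 0) \<epsilon>" and d: "linear_map R (E i) (E (Suc i)) (d i)"
    and \<epsilon>_inj: "inj_on \<epsilon> (carrier R)"
    and ex0: "\<epsilon> ` carrier R = {x \<in> carrier (E 0). d 0 x = \<zero>\<^bsub>E 1\<^esub>}"
    and ex: "d i ` carrier (E i) = {x \<in> carrier (E (Suc i)). d (Suc i) x = \<zero>\<^bsub>E (Suc (Suc i))\<^esub>}"
    for i
    using res unfolding injective_resolution_def by (auto simp: self_module_def)
  have E: "module R (E i)" for i using inj unfolding injective_module_def by blast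
  interpret M: module R "self_module R" by fact
  interpret E0: module R "E 0" by (rule E)
  interpret E1: module R "E 1" by (rule E)
  have pw: "a \<in> carrier R" if "a \<in> ideal_pow R I k" for a k
    using ideal.Icarr[OF M.ideal_pow_ideal[OF I] that] .
  have \<epsilon>c: "\<epsilon> y \<in> carrier (E 0)" if "y \<in> carrier R" for y
    using linear_map_simps(1)[OF \<epsilon>] that by (simp add: self_module_def)
  have \<epsilon>m: "\<epsilon> (a \<otimes>\<^bsub>R\<^esub> y) = a \<odot>\<^bsub>E 0\<^esub> \<epsilon> y" if "a \<in> carrier R" "y \<in> carrier R" for a y
    using linear_map_simps(3)[OF \<epsilon>, of a y] that by (simp add: self_module_def)
  have d0: "linear_map R (E 0) (E 1) (d 0)" using d[of 0] by simp
  have T0: "submodule (torsion R I (E 0)) R (E 0)" by (rule submodule_torsion[OF E I])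
  have cob: "torsion_coboundaries R I E d 1 = d 0 ` torsion R I (E 0)"
    unfolding torsion_coboundaries_def by simp
  have N: "submodule (torsion_coboundaries R I E d 1) R (E 1)"
    unfolding cob by (rule submodule_linear_image[OF E E d0 T0])
  have NZ: "torsion_coboundaries R I E d 1 \<subseteq> torsion_cocycles R I E d 1"
  proof
    fix z assume "z \<in> torsion_coboundaries R I E d 1"
    then obtain y where y: "y \<in> torsion R I (E 0)" "z = d 0 y" unfolding cob by blast
    then have "z \<in> d 0 ` carrier (E 0)" by (auto simp: torsion_def)
    then have "d 1 z = \<zero>\<^bsub>E (Suc 1)\<^esub>" using ex[of 0] by auto
    then show "z \<in> torsion_cocycles R I E d 1"
      using linear_map_torsion[OF E E d0 I y(1)] y(2) by (simp add: torsion_cocycles_def)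
  qed
  have cocycle: "z \<in> torsion_cocycles R I E d 1 \<longleftrightarrow>
      (\<exists>y\<in>carrier (E 0). z = d 0 y \<and> (\<exists>k. \<forall>u\<in>ideal_pow R I k. u \<odot>\<^bsub>E 0\<^esub> y \<in> \<epsilon> ` carrier R))" for z
  proof -
    have "z \<in> torsion_cocycles R I E d 1 \<longleftrightarrow>
        z \<in> d 0 ` carrier (E 0) \<and> (\<exists>k. \<forall>u\<in>ideal_pow R I k. u \<odot>\<^bsub>E 1\<^esub> z = \<zero>\<^bsub>E 1\<^esub>)"
      using ex[of 0] by (auto simp: torsion_cocycles_def torsion_def)
    moreover have "u \<odot>\<^bsub>E 1\<^esub> d 0 y = \<zero>\<^bsub>E 1\<^esub> \<longleftrightarrow> u \<odot>\<^bsub>E 0\<^esub> y \<in> \<epsilon> ` carrier R"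
      if "u \<in> ideal_pow R I k" "y \<in> carrier (E 0)" for u y k
      unfolding ex0 using that pw linear_map_simps(3)[OF d0, of u y] by auto
    ultimately show ?thesis by (auto 4 4)
  qed
  have iff: "annihilates J (local_cohomology R I E d 1) \<longleftrightarrow>
      (\<forall>a\<in>J. \<forall>z\<in>torsion_cocycles R I E d 1. a \<odot>\<^bsub>E 1\<^esub> z \<in> d 0 ` torsion R I (E 0))"
    unfolding local_cohomology_def cob[symmetric]
    by (rule annihilates_quotient_iff[OF E N NZ _ J])
      (auto simp: torsion_cocycles_def torsion_def)
  show ?thesis
    unfolding iff
  proof (intro iffI allI ballI impI)
    fix k \<phi> a
    assume *: "\<forall>a\<in>J. \<forall>z\<in>torsion_cocycles R I E d 1. a \<odot>\<^bsub>E 1\<^esub> z \<in> d 0 ` torsion R I (E 0)"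
      and a: "a \<in> J" 
      and \<phi>: "linear_map R (self_module R\<lparr>carrier := ideal_pow R I k\<rparr>) (self_module R) \<phi>"
    let ?A = "self_module R\<lparr>carrier := ideal_pow R I k\<rparr>"
    have aR: "a \<in> carrier R" using a J by blast
    have \<phi>c: "\<phi> u \<in> carrier R" if "u \<in> ideal_pow R I k" for u
      using linear_map_simps(1)[OF \<phi>] that by (simp add: self_module_def)
    have A: "module R ?A"
      using submodule.submodule_is_module[OF submodule_ideal[OF M M.ideal_pow_ideal[OF I]] M] .
    have "linear_map R ?A (self_module R) id"
      unfolding linear_map_def using pw by (auto simp: self_module_def)
    moreover have "linear_map R ?A (E 0) (\<epsilon> \<circ> \<phi>)"
      using \<phi> \<epsilon> unfolding linear_map_def by (auto simp: Pi_iff)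
    ultimately obtain H where H: "linear_map R (self_module R) (E 0) H"
        "\<forall>u\<in>carrier ?A. H (id u) = (\<epsilon> \<circ> \<phi>) u"
      using inj[of 0, unfolded injective_module_def, THEN conjunct2, rule_format,
          of ?A "self_module R" id "\<epsilon> \<circ> \<phi>"] A M by auto
    define y where "y = H \<one>\<^bsub>R\<^esub>"
    have y: "y \<in> carrier (E 0)"
      using linear_map_simps(1)[OF H(1)] by (simp add: y_def self_module_def)
    have uy: "u \<odot>\<^bsub>E 0\<^esub> y = \<epsilon> (\<phi> u)" if u: "u \<in> ideal_pow R I k" for u
    proof -
      have "u \<odot>\<^bsub>E 0\<^esub> y = H (u \<otimes>\<^bsub>R\<^esub> \<one>\<^bsub>R\<^esub>)"
        using linear_map_simps(3)[OF H(1), of u "\<one>\<^bsub>R\<^esub>"] pw[OF u]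
        by (simp add: y_def self_module_def)
      then show ?thesis using pw[OF u] H(2) u by simp
    qed
    have "d 0 y \<in> torsion_cocycles R I E d 1"
      unfolding cocycle using y uy \<phi>c by blast
    then have "a \<odot>\<^bsub>E 1\<^esub> d 0 y \<in> d 0 ` torsion R I (E 0)" using * a by blast
    then obtain g where g: "g \<in> torsion R I (E 0)" "a \<odot>\<^bsub>E 1\<^esub> d 0 y = d 0 g" by blast
    then obtain l where gc: "g \<in> carrier (E 0)"
        and gl: "\<And>v. v \<in> ideal_pow R I l \<Longrightarrow> v \<odot>\<^bsub>E 0\<^esub> g = \<zero>\<^bsub>E 0\<^esub>"
      unfolding torsion_def by blast
    \<comment> \<open>\<open>?w\<close> is a cocycle in \<open>E 0\<close>, so it comes from \<open>R\<close>.\<close>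
    let ?w = "a \<odot>\<^bsub>E 0\<^esub> y \<oplus>\<^bsub>E 0\<^esub> \<ominus>\<^bsub>E 0\<^esub> g"
    have ay: "a \<odot>\<^bsub>E 0\<^esub> y \<in> carrier (E 0)" using aR y by simp
    have "d 0 ?w = d 0 g \<oplus>\<^bsub>E 1\<^esub> \<ominus>\<^bsub>E 1\<^esub> d 0 g"
      using linear_map_simps[OF d0] linear_map_minus[OF E E d0] ay gc aR y g(2) by simp
    also have "\<dots> = \<zero>\<^bsub>E 1\<^esub>" using linear_map_simps(1)[OF d0 gc] E1.M.r_neg by simp
    finally have "?w \<in> \<epsilon> ` carrier R" unfolding ex0 using ay gc by simp
    then obtain h where h: "h \<in> carrier R" "?w = \<epsilon> h" by blast
    have powx: "x [^]\<^bsub>R\<^esub> l \<in> ideal_pow R I l"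
    proof (induction l)
      case (Suc l)
      have "x \<otimes>\<^bsub>R\<^esub> x [^]\<^bsub>R\<^esub> l \<in> ideal_pow R I (Suc l)"
        using ideal_prod.prod[OF x Suc] by simp
      then show ?case using ideal.Icarr[OF I x] by (simp add: M.R.m_comm)
    qed simp
    have regl: "y = \<zero>\<^bsub>R\<^esub>" if "y \<in> carrier R" "x [^]\<^bsub>R\<^esub> (l::nat) \<otimes>\<^bsub>R\<^esub> y = \<zero>\<^bsub>R\<^esub>" for y l
      using that
    proof (induction l arbitrary: y)
      case (Suc l)
      have "x [^]\<^bsub>R\<^esub> l \<otimes>\<^bsub>R\<^esub> (x \<otimes>\<^bsub>R\<^esub> y) = \<zero>\<^bsub>R\<^esub>"
        using Suc.prems ideal.Icarr[OF I x] by (simp add: M.R.m_assoc)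
      then have "x \<otimes>\<^bsub>R\<^esub> y = \<zero>\<^bsub>R\<^esub>" using Suc.IH Suc.prems(1) ideal.Icarr[OF I x] by blast
      then show ?case using reg Suc.prems(1) by blast
    qed simp
    have "a \<otimes>\<^bsub>R\<^esub> \<phi> u = h \<otimes>\<^bsub>R\<^esub> u" if u: "u \<in> ideal_pow R I k" for u
    proof -
      let ?v = "x [^]\<^bsub>R\<^esub> l"
      have v: "?v \<in> carrier R" using pw[OF powx] .
      note uR = pw[OF u]
      have "\<epsilon> (?v \<otimes>\<^bsub>R\<^esub> (h \<otimes>\<^bsub>R\<^esub> u)) = \<epsilon> ((u \<otimes>\<^bsub>R\<^esub> ?v) \<otimes>\<^bsub>R\<^esub> h)"
        using h v uR by (simp add: M.R.m_ac)
      also have "\<dots> = (u \<otimes>\<^bsub>R\<^esub> ?v) \<odot>\<^bsub>E 0\<^esub> ?w" unfolding h(2) using h v uR \<epsilon>m by simp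
      also have "\<dots> = u \<odot>\<^bsub>E 0\<^esub> (?v \<odot>\<^bsub>E 0\<^esub> (a \<odot>\<^bsub>E 0\<^esub> y) \<oplus>\<^bsub>E 0\<^esub> ?v \<odot>\<^bsub>E 0\<^esub> (\<ominus>\<^bsub>E 0\<^esub> g))"
        using v uR ay gc by (simp add: E0.smult_assoc1 E0.smult_r_distr)
      also have "?v \<odot>\<^bsub>E 0\<^esub> (\<ominus>\<^bsub>E 0\<^esub> g) = \<zero>\<^bsub>E 0\<^esub>"
        using gl[OF powx] v gc by (simp add: E0.smult_r_minus)
      also have "u \<odot>\<^bsub>E 0\<^esub> (?v \<odot>\<^bsub>E 0\<^esub> (a \<odot>\<^bsub>E 0\<^esub> y) \<oplus>\<^bsub>E 0\<^esub> \<zero>\<^bsub>E 0\<^esub>) = (?v \<otimes>\<^bsub>R\<^esub> a) \<odot>\<^bsub>E 0\<^esub> (u \<odot>\<^bsub>E 0\<^esub> y)"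
        using v uR ay aR y by (simp add: M.R.m_ac flip: E0.smult_assoc1)
      also have "\<dots> = \<epsilon> ((?v \<otimes>\<^bsub>R\<^esub> a) \<otimes>\<^bsub>R\<^esub> \<phi> u)" using uy[OF u] \<epsilon>m \<phi>c[OF u] v aR by simp
      finally have "?v \<otimes>\<^bsub>R\<^esub> (h \<otimes>\<^bsub>R\<^esub> u) = ?v \<otimes>\<^bsub>R\<^esub> a \<otimes>\<^bsub>R\<^esub> \<phi> u"
        using \<epsilon>_inj v h uR aR \<phi>c[OF u] by (auto dest: inj_onD)
      then have "?v \<otimes>\<^bsub>R\<^esub> (a \<otimes>\<^bsub>R\<^esub> \<phi> u \<ominus>\<^bsub>R\<^esub> h \<otimes>\<^bsub>R\<^esub> u) = \<zero>\<^bsub>R\<^esub>"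
        using v h uR aR \<phi>c[OF u]
        by (simp add: M.R.minus_eq M.R.r_distr M.R.r_minus M.R.m_assoc M.R.r_neg)
      then have "a \<otimes>\<^bsub>R\<^esub> \<phi> u \<ominus>\<^bsub>R\<^esub> h \<otimes>\<^bsub>R\<^esub> u = \<zero>\<^bsub>R\<^esub>"
        by (rule regl[rotated]) (use h uR aR \<phi>c[OF u] in simp)
      then show ?thesis using h uR aR \<phi>c[OF u] by simp
    qed
    then show "\<exists>h\<in>carrier R. \<forall>u\<in>ideal_pow R I k. a \<otimes>\<^bsub>R\<^esub> \<phi> u = h \<otimes>\<^bsub>R\<^esub> u" using h by blast
  next
    fix a z
    assume *: "\<forall>k \<phi>. \<forall>a\<in>J. linear_map R (self_module R\<lparr>carrier := ideal_pow R I k\<rparr>) (self_module R) \<phi> \<longrightarrow>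
       (\<exists>h\<in>carrier R. \<forall>u\<in>ideal_pow R I k. a \<otimes>\<^bsub>R\<^esub> \<phi> u = h \<otimes>\<^bsub>R\<^esub> u)"
      and a: "a \<in> J" and z: "z \<in> torsion_cocycles R I E d 1"
    have aR: "a \<in> carrier R" using a J by blast
    obtain y k where y: "y \<in> carrier (E 0)" "z = d 0 y"
        and k: "\<And>u. u \<in> ideal_pow R I k \<Longrightarrow> u \<odot>\<^bsub>E 0\<^esub> y \<in> \<epsilon> ` carrier R"
      using z unfolding cocycle by blast
    define \<phi> where "\<phi> u = the_inv_into (carrier R) \<epsilon> (u \<odot>\<^bsub>E 0\<^esub> y)" for u
    have \<phi>: "\<phi> u \<in> carrier R" "\<epsilon> (\<phi> u) = u \<odot>\<^bsub>E 0\<^esub> y" if "u \<in> ideal_pow R I k" for u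
      unfolding \<phi>_def using the_inv_into_into[OF \<epsilon>_inj k[OF that] subset_refl]
        f_the_inv_into_f[OF \<epsilon>_inj k[OF that]] by auto
    have \<phi>_unique: "\<phi> u = w" if "w \<in> carrier R" "\<epsilon> w = u \<odot>\<^bsub>E 0\<^esub> y" for u w
      unfolding \<phi>_def using that the_inv_into_f_f[OF \<epsilon>_inj] by metis
    interpret P: ideal "ideal_pow R I k" R by (rule M.ideal_pow_ideal[OF I])
    have \<epsilon>a: "\<epsilon> (v \<oplus>\<^bsub>R\<^esub> w) = \<epsilon> v \<oplus>\<^bsub>E 0\<^esub> \<epsilon> w" if "v \<in> carrier R" "w \<in> carrier R" for v w
      using linear_map_simps(2)[OF \<epsilon>, of v w] that by (simp add: self_module_def)
    have lin: "linear_map R (self_module R\<lparr>carrier := ideal_pow R I k\<rparr>) (self_module R) \<phi>"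
      unfolding linear_map_def
    proof (intro conjI ballI)
      show "\<phi> \<in> carrier (self_module R\<lparr>carrier := ideal_pow R I k\<rparr>) \<rightarrow> carrier (self_module R)"
        using \<phi> by (auto simp: self_module_def)
    next
      fix u v assume "u \<in> carrier (self_module R\<lparr>carrier := ideal_pow R I k\<rparr>)"
        "v \<in> carrier (self_module R\<lparr>carrier := ideal_pow R I k\<rparr>)"
      then have uv: "u \<in> ideal_pow R I k" "v \<in> ideal_pow R I k" by auto
      have "\<phi> (u \<oplus>\<^bsub>R\<^esub> v) = \<phi> u \<oplus>\<^bsub>R\<^esub> \<phi> v"
        by (rule \<phi>_unique) (use uv \<phi> y pw in \<open>auto simp: \<epsilon>a E0.smult_l_distr\<close>)
      then show "\<phi> (u \<oplus>\<^bsub>self_module R\<lparr>carrier := ideal_pow R I k\<rparr>\<^esub> v) = \<phi> u \<oplus>\<^bsub>self_module R\<^esub> \<phi> v"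
        by (simp add: self_module_def)
    next
      fix r u assume r: "r \<in> carrier R" and "u \<in> carrier (self_module R\<lparr>carrier := ideal_pow R I k\<rparr>)"
      then have u: "u \<in> ideal_pow R I k" by auto
      have "\<phi> (r \<otimes>\<^bsub>R\<^esub> u) = r \<otimes>\<^bsub>R\<^esub> \<phi> u"
        by (rule \<phi>_unique) (use u r \<phi> y pw in \<open>auto simp: \<epsilon>m E0.smult_assoc1\<close>)
      then show "\<phi> (r \<odot>\<^bsub>self_module R\<lparr>carrier := ideal_pow R I k\<rparr>\<^esub> u) = r \<odot>\<^bsub>self_module R\<^esub> \<phi> u"
        by (simp add: self_module_def)
    qed
    obtain h where h: "h \<in> carrier R"
        and hu: "\<And>u. u \<in> ideal_pow R I k \<Longrightarrow> a \<otimes>\<^bsub>R\<^esub> \<phi> u = h \<otimes>\<^bsub>R\<^esub> u"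
      using *[rule_format, OF a lin] by blast
    \<comment> \<open>Subtracting \<open>\<epsilon> h\<close> does not change the image under \<open>d\<close> and makes the element torsion.\<close>
    let ?g = "a \<odot>\<^bsub>E 0\<^esub> y \<oplus>\<^bsub>E 0\<^esub> \<ominus>\<^bsub>E 0\<^esub> \<epsilon> h"
    have ay: "a \<odot>\<^bsub>E 0\<^esub> y \<in> carrier (E 0)" using aR y by simp
    have "u \<odot>\<^bsub>E 0\<^esub> ?g = \<zero>\<^bsub>E 0\<^esub>" if u: "u \<in> ideal_pow R I k" for u
    proof -
      have "u \<odot>\<^bsub>E 0\<^esub> (a \<odot>\<^bsub>E 0\<^esub> y) = a \<odot>\<^bsub>E 0\<^esub> \<epsilon> (\<phi> u)"
        using \<phi>(2)[OF u] pw[OF u] aR y by (simp add: M.R.m_comm flip: E0.smult_assoc1)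
      also have "\<dots> = \<epsilon> (h \<otimes>\<^bsub>R\<^esub> u)" using \<phi>(1)[OF u] aR by (simp add: hu[OF u] flip: \<epsilon>m)
      also have "\<dots> = u \<odot>\<^bsub>E 0\<^esub> \<epsilon> h" using pw[OF u] h by (simp add: M.R.m_comm flip: \<epsilon>m)
      finally show ?thesis
        using pw[OF u] ay \<epsilon>c[OF h] by (simp add: E0.smult_r_distr E0.smult_r_minus E0.M.r_neg)
    qed
    then have "?g \<in> torsion R I (E 0)" unfolding torsion_def using ay \<epsilon>c[OF h] by auto
    moreover have "d 0 ?g = a \<odot>\<^bsub>E 1\<^esub> z"
    proof -
      have "d 0 (\<epsilon> h) = \<zero>\<^bsub>E 1\<^esub>" using ex0 h by auto
      then show ?thesis
        using linear_map_simps[OF d0] linear_map_minus[OF E E d0] ay \<epsilon>c[OF h] aR y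
        by (simp del: One_nat_def)
    qed
    ultimately show "a \<odot>\<^bsub>E 1\<^esub> z \<in> d 0 ` torsion R I (E 0)" by (metis imageI)
  qed
qed

section \<open>Multiplication by monomials\<close>

lemma single_mult_lookup:
  fixes f :: "'a::cancel_comm_monoid_add \<Rightarrow>\<^sub>0 'k::comm_semiring_1"
  shows "Poly_Mapping.lookup (Poly_Mapping.single u 1 * f) (u + w) = Poly_Mapping.lookup f w"
  by (simp add: lookup_mult lookup_single when_mult)

lemma single_mult_keys:
  fixes f :: "'a::cancel_comm_monoid_add \<Rightarrow>\<^sub>0 'k::comm_semiring_1"
  shows "Poly_Mapping.keys (Poly_Mapping.single u 1 * f) = (+) u ` Poly_Mapping.keys f"
proof
  show "Poly_Mapping.keys (Poly_Mapping.single u 1 * f) \<subseteq> (+) u ` Poly_Mapping.keys f"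
    using keys_mult[of "Poly_Mapping.single u 1" f] by fastforce
  show "(+) u ` Poly_Mapping.keys f \<subseteq> Poly_Mapping.keys (Poly_Mapping.single u 1 * f)"
    by (auto simp: in_keys_iff single_mult_lookup)
qed

lemma single_mult_cancel:
  fixes f :: "'a::cancel_comm_monoid_add \<Rightarrow>\<^sub>0 'k::comm_semiring_1"
  shows "Poly_Mapping.single u 1 * f = Poly_Mapping.single u 1 * g \<longleftrightarrow> f = g"
  by (metis single_mult_lookup poly_mapping_eqI)

lemma sum_of_monomials:
  fixes f :: "'a \<Rightarrow>\<^sub>0 'k::comm_monoid_add"
  shows "(\<Sum>w\<in>Poly_Mapping.keys f. Poly_Mapping.single w (Poly_Mapping.lookup f w)) = f"
  by (rule poly_mapping_eqI)
    (simp add: lookup_sum lookup_single when_def in_keys_iff)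

lemma single_dvd:
  fixes f :: "'a::cancel_comm_monoid_add \<Rightarrow>\<^sub>0 'k::comm_semiring_1"
  assumes "Poly_Mapping.keys f \<subseteq> range ((+) u)"
  obtains g where "f = Poly_Mapping.single u 1 * g"
proof -
  define s where "s w = (SOME v. w = u + v)" for w
  have s: "u + s w = w" if "w \<in> Poly_Mapping.keys f" for w
    unfolding s_def using assms that by (metis (mono_tags, lifting) imageE someI subsetD)
  have "Poly_Mapping.single u 1 *
      (\<Sum>w\<in>Poly_Mapping.keys f. Poly_Mapping.single (s w) (Poly_Mapping.lookup f w)) =
      (\<Sum>w\<in>Poly_Mapping.keys f. Poly_Mapping.single w (Poly_Mapping.lookup f w))"
    unfolding sum_distrib_left by (rule sum.cong) (simp_all add: mult_single s)
  then show ?thesis using that by (metis sum_of_monomials)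
qed

section \<open>The exponent semigroup and the monomial ring\<close>

definition exponents :: "nat \<Rightarrow> (nat \<times> nat) set" where
  "exponents n = {(p, q). \<exists>m. p + q = m * (6 * n + 15) \<and> sum_of_gens n m q}"

lemma exponents_add: "u \<in> exponents n \<Longrightarrow> v \<in> exponents n \<Longrightarrow> u + v \<in> exponents n"
proof -
  assume "u \<in> exponents n" "v \<in> exponents n"
  then obtain p q m p' q' m' where *: "u = (p, q)" "p + q = m * (6 * n + 15)" "sum_of_gens n m q"
      "v = (p', q')" "p' + q' = m' * (6 * n + 15)" "sum_of_gens n m' q'"
    unfolding exponents_def by blast
  then have "(p + p') + (q + q') = (m + m') * (6 * n + 15)" by (simp add: algebra_simps)
  then show ?thesis unfolding exponents_def using sum_of_gens_add[OF *(3,6)] * by auto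
qed

text \<open>
  Both \<open>v\<close> and \<open>u + v\<close> satisfy the saturation conditions, so each lies in the semigroup unless its
  degree is \<open>2\<close> or \<open>3\<close>. As \<open>u\<close> has degree at least \<open>2\<close>, the degrees of \<open>v\<close> and \<open>u + v\<close> cannot both be
  exceptional. This is why \<open>\<mm>\<^sup>2\<close> kills the first local cohomology.
\<close>
lemma exponents_absorb:
  assumes n: "n \<ge> 1" and u: "u \<in> exponents n" "fst u + snd u \<ge> 2 * (6 * n + 15)"
    and v1: "v + (k * (6 * n + 15), 0) \<in> exponents n" and v2: "v + (0, k * (6 * n + 15)) \<in> exponents n"
  shows "u + v \<in> exponents n"
proof -
  let ?D = "6 * n + 15"
  have saturated: "w \<in> exponents n"
    if w1: "w + (k * ?D, 0) \<in> exponents n" and w2: "w + (0, k * ?D) \<in> exponents n"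
      and deg: "fst w + snd w = m * ?D" and m: "m \<noteq> 2" "m \<noteq> 3" for w m
  proof -
    obtain p q where w: "w = (p, q)" by fastforce
    obtain m' where 1: "sum_of_gens n m' q" using w1 unfolding w exponents_def by auto
    obtain m'' where 2: "sum_of_gens n m'' (q + k * ?D)" "p + (q + k * ?D) = m'' * ?D"
      using w2 unfolding w exponents_def by auto
    show ?thesis
      using sum_of_gens_if_saturated[OF n _ 1 2 m] deg unfolding w exponents_def by auto
  qed
  obtain p q where v: "v = (p, q)" by fastforce
  obtain a where "p + k * ?D + q = a * ?D" using v1 unfolding v exponents_def by auto
  then have "p + q = a * ?D - k * ?D" by linarith
  then obtain m where m: "p + q = m * ?D" by (metis diff_mult_distrib)
  obtain b where b: "fst u + snd u = b * ?D" using u(1) unfolding exponents_def by auto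
  have "b * ?D \<ge> 2 * ?D" using u(2) b by simp
  then have b2: "b \<ge> 2" by (metis mult_le_cancel2 zero_less_numeral add_gr_0)
  have deg: "fst (u + v) + snd (u + v) = (b + m) * ?D"
    using b m v by (simp add: algebra_simps)
  have uv: "(u + v) + (k * ?D, 0) \<in> exponents n" "(u + v) + (0, k * ?D) \<in> exponents n"
    using exponents_add[OF u(1) v1] exponents_add[OF u(1) v2] by (simp_all add: add.assoc)
  show ?thesis
  proof (cases "b + m = 2 \<or> b + m = 3")
    case True
    then have "m \<noteq> 2" "m \<noteq> 3" using b2 by auto
    then have "v \<in> exponents n" using saturated[OF v1 v2] m v by simp
    then show ?thesis using exponents_add u(1) by blast
  next
    case False
    then show ?thesis using saturated[OF uv deg] by blast
  qed
qed

lemma cring_poly2: "cring poly2_ring"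
proof (rule cringI)
  show "abelian_group (poly2_ring :: 'k::field poly2 ring)"
    by (rule abelian_groupI) (auto simp: poly2_ring_def add_ac intro: exI[of _ "- _"] )
  show "comm_monoid (poly2_ring :: 'k::field poly2 ring)"
    by (rule comm_monoidI) (auto simp: poly2_ring_def mult_ac)
qed (auto simp: poly2_ring_def algebra_simps)

lemma poly2_ring_minus: "\<ominus>\<^bsub>poly2_ring\<^esub> f = - f"
proof -
  interpret cring poly2_ring by (rule cring_poly2)
  show ?thesis by (rule minus_equality) (simp_all add: poly2_ring_def)
qed

lemma monomial_ring_simps:
  "mult (monomial_ring n r) = (*)" "add (monomial_ring n r) = (+)"
  "one (monomial_ring n r) = 1" "zero (monomial_ring n r) = 0"
  by (simp_all add: monomial_ring_def poly2_ring_def)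

lemma cring_monomial_ring: "cring (monomial_ring n r)"
proof -
  interpret cring poly2_ring by (rule cring_poly2)
  show ?thesis
    unfolding monomial_ring_def
    by (intro subcring_iff[THEN iffD1] subcringI' generate_ring_is_subring)
      (auto simp: poly2_ring_def)
qed

text \<open>
  With \<open>e = 0\<close> this is the monomial ring itself; for \<open>e > 0\<close> it is the ideal that bounds the powers
  of the homogeneous maximal ideal from above.
\<close>
definition high_part :: "nat \<Rightarrow> nat \<Rightarrow> 'k::field poly2 set" where
  "high_part n e = {f. \<forall>w\<in>Poly_Mapping.keys f. w \<in> exponents n \<and> e \<le> fst w + snd w}"

lemma high_part_add: "f \<in> high_part n e \<Longrightarrow> g \<in> high_part n e \<Longrightarrow> f + g \<in> high_part n e"
  unfolding high_part_def using keys_add[of f g] by blast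

lemma high_part_minus: "f \<in> high_part n e \<Longrightarrow> - f \<in> high_part n e"
  unfolding high_part_def by (simp add: in_keys_iff)

lemma high_part_mult:
  assumes "f \<in> high_part n e" "g \<in> high_part n e'" shows "f * g \<in> high_part n (e + e')"
proof -
  have "w \<in> exponents n \<and> e + e' \<le> fst w + snd w" if w_key: "w \<in> Poly_Mapping.keys (f * g)" for w
  proof -
    obtain u v where "w = u + v" "u \<in> Poly_Mapping.keys f" "v \<in> Poly_Mapping.keys g"
      using w_key keys_mult[of f g] by blast
    then show ?thesis using assms exponents_add unfolding high_part_def by fastforce
  qed
  then show ?thesis unfolding high_part_def by blast
qed

lemma zero_in_exponents: "0 \<in> exponents n"
  unfolding exponents_def zero_prod_def by (auto intro!: exI[of _ 0] sum_of_gensI[of 0 0 0 _ 0])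

text \<open>The pure power of \<open>t\<close> joins the family of odd exponents as its case \<open>v = 0\<close>.\<close>
lemma monomial_gens_eq:
  "(monomial_gens n (2 * n + 8) :: 'k::field poly2 set) =
     insert (Poly_Mapping.single (6 * n + 15, 0) 1)
       (insert (Poly_Mapping.single (4 * n + 7, 2 * n + 8) 1)
         (insert (Poly_Mapping.single (2 * n + 1, 4 * n + 14) 1)
           {Poly_Mapping.single (2 * v, 4 * n + 15 + 2 * i) 1 | i v. i + v = n}))"
proof -
  have a: "exp_a (2 * n + 8) i = 4 * n + 15 + 2 * i" for i by (simp add: exp_a_def)
  have "{monom2 (exp_a (2 * n + 8) n - exp_a (2 * n + 8) i) (exp_a (2 * n + 8) i) | i. i < n} \<union>
      {(monom2 0 (exp_a (2 * n + 8) n) :: 'k poly2)} =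
      {Poly_Mapping.single (2 * v, 4 * n + 15 + 2 * i) 1 | i v. i + v = n}" (is "?L = ?R")
  proof (intro equalityI subsetI)
    fix f assume "f \<in> ?L"
    then obtain i where "i \<le> n"
        and f: "f = monom2 (exp_a (2 * n + 8) n - exp_a (2 * n + 8) i) (exp_a (2 * n + 8) i)"
      by (elim UnE) (blast intro: less_imp_le, metis diff_self_eq_0 order_refl singletonD)
    then obtain v where v: "i + v = n" using le_Suc_ex by blast
    then have "f = Poly_Mapping.single (2 * v, 4 * n + 15 + 2 * i) 1"
      unfolding f a monom2_def by auto
    then show "f \<in> ?R" using v by blast
  next
    fix f assume "f \<in> ?R"
    then obtain i v where *: "i + v = n" "f = Poly_Mapping.single (2 * v, 4 * n + 15 + 2 * i) 1"
      by blast
    then have "f = monom2 (exp_a (2 * n + 8) n - exp_a (2 * n + 8) i) (exp_a (2 * n + 8) i)"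
      by (auto simp: a monom2_def)
    moreover have "i < n \<or> i = n" using *(1) by linarith
    ultimately show "f \<in> ?L" by auto
  qed
  moreover have "monom2 (exp_a (2 * n + 8) n) 0 = (Poly_Mapping.single (6 * n + 15, 0) 1 :: 'k poly2)"
    "monom2 (exp_a (2 * n + 8) n - exp_b1 (2 * n + 8)) (exp_b1 (2 * n + 8)) =
       (Poly_Mapping.single (4 * n + 7, 2 * n + 8) 1 :: 'k poly2)"
    "monom2 (exp_a (2 * n + 8) n - exp_b2 (2 * n + 8)) (exp_b2 (2 * n + 8)) =
       (Poly_Mapping.single (2 * n + 1, 4 * n + 14) 1 :: 'k poly2)"
    by (simp_all add: a exp_b1_def exp_b2_def monom2_def add.commute)
  ultimately show ?thesis
    unfolding monomial_gens_def Un_assoc by (simp only: Un_insert_left Un_empty_left)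
qed

lemma pure_powers_in_gens:
  "Poly_Mapping.single (6 * n + 15, 0) 1 \<in> monomial_gens n (2 * n + 8)"
  "Poly_Mapping.single (0, 6 * n + 15) 1 \<in> monomial_gens n (2 * n + 8)"
proof -
  show "Poly_Mapping.single (0, 6 * n + 15) 1 \<in> monomial_gens n (2 * n + 8)"
    unfolding monomial_gens_eq by (intro insertI2 CollectI exI[of _ n] exI[of _ 0]) simp
qed (simp add: monomial_gens_eq)

lemma monomial_gens_high: "monomial_gens n (2 * n + 8) \<subseteq> high_part n (6 * n + 15)"
proof -
  have high: "Poly_Mapping.single (p, q) 1 \<in> high_part n (6 * n + 15)"
    if "p + q = 6 * n + 15" "sum_of_gens n 1 q" for p q
    unfolding high_part_def exponents_def using that by (auto intro!: exI[of _ 1])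
  have "Poly_Mapping.single (6 * n + 15, 0) 1 \<in> high_part n (6 * n + 15)"
    by (rule high) (auto intro!: sum_of_gensI[of 0 0 0 _ 0])
  moreover have "Poly_Mapping.single (4 * n + 7, 2 * n + 8) 1 \<in> high_part n (6 * n + 15)"
    by (rule high) (auto intro!: sum_of_gensI[of 1 0 0 _ 0])
  moreover have "Poly_Mapping.single (2 * n + 1, 4 * n + 14) 1 \<in> high_part n (6 * n + 15)"
    by (rule high) (auto intro!: sum_of_gensI[of 0 1 0 _ 0])
  moreover have "Poly_Mapping.single (2 * v, 4 * n + 15 + 2 * i) 1 \<in> high_part n (6 * n + 15)"
    if "i + v = n" for i v
    using that by (intro high) (auto intro!: sum_of_gensI[of 0 0 1 _ i])
  ultimately show ?thesis
    unfolding monomial_gens_eq by blast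
qed

text \<open>
  A monomial with exponents in the semigroup is a product of generators: \<open>exponent_decomposition\<close>
  separates the even exponents, and the odd part loses one generator \<open>(2 * v1, 4 * n + 15 + 2 * i1)\<close>
  with \<open>i1 + v1 = n\<close> at a time, \<open>i1\<close> being taken as large as possible.
\<close>
lemma carrier_monomial_ring:
  "carrier (monomial_ring n (2 * n + 8)) = (high_part n 0 :: 'k::field poly2 set)"
proof -
  define G where "G = (carrier (monomial_ring n (2 * n + 8)) :: 'k poly2 set)"
  let ?H = "range const2 \<union> monomial_gens n (2 * n + 8) :: 'k poly2 set"
  have G: "G = generate_ring poly2_ring ?H" unfolding G_def monomial_ring_def by simp
  have G_gen: "f \<in> G" if "f \<in> ?H" for f using that unfolding G by (rule generate_ring.incl)
  have G_one: "1 \<in> G" using generate_ring.one[of poly2_ring ?H] unfolding G by (simp add: poly2_ring_def)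
  have G_mult: "f * g \<in> G" if "f \<in> G" "g \<in> G" for f g
    using generate_ring.eng_mult[of f poly2_ring ?H g] that unfolding G by (simp add: poly2_ring_def)
  have G_add: "f + g \<in> G" if "f \<in> G" "g \<in> G" for f g
    using generate_ring.eng_add[of f poly2_ring ?H g] that unfolding G by (simp add: poly2_ring_def)
  have G_power: "Poly_Mapping.single (k * p, k * q) 1 \<in> G"
    if "Poly_Mapping.single (p, q) 1 \<in> G" for k p q
  proof (induction k)
    case 0
    then show ?case using G_one by (simp flip: zero_prod_def)
  next
    case (Suc k)
    then show ?case using G_mult[OF that Suc] by (simp add: mult_single)
  qed
  have G_odd: "Poly_Mapping.single (2 * v, j * (4 * n + 15) + 2 * i) 1 \<in> G" if "i + v = j * n" for i v j
    using that
  proof (induction j arbitrary: i v)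
    case 0
    then show ?case using G_one by (simp flip: zero_prod_def)
  next
    case (Suc j)
    obtain i1 v1 i2 v2 where *: "i1 + v1 = n" "i2 + v2 = j * n" "i = i1 + i2" "v = v1 + v2"
    proof (cases "i \<le> n")
      case True
      then show ?thesis using Suc.prems by (intro that[of i "n - i" 0 "j * n"]) auto
    next
      case False
      then show ?thesis using Suc.prems by (intro that[of n 0 "i - n" v]) auto
    qed
    have "Poly_Mapping.single (2 * v1, 4 * n + 15 + 2 * i1) 1 \<in> G"
      using *(1) by (intro G_gen) (auto simp: monomial_gens_eq)
    from G_mult[OF this Suc.IH[OF *(2)]] show ?case
      unfolding *(3,4) by (simp add: mult_single algebra_simps)
  qed
  have G_monom: "Poly_Mapping.single w 1 \<in> G" if "w \<in> exponents n" for w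
  proof -
    obtain p q m where w: "w = (p, q)" "p + q = m * (6 * n + 15)" "sum_of_gens n m q"
      using \<open>w \<in> exponents n\<close> unfolding exponents_def by blast
    obtain u c f j i v where *: "i + v = j * n"
      "p = u * (6 * n + 15) + c * (4 * n + 7) + f * (2 * n + 1) + 2 * v"
      "q = c * (2 * n + 8) + f * (4 * n + 14) + j * (4 * n + 15) + 2 * i"
      using exponent_decomposition[OF w(3,2)] by metis
    have "Poly_Mapping.single (u * (6 * n + 15), u * 0) 1 \<in> G"
      "Poly_Mapping.single (c * (4 * n + 7), c * (2 * n + 8)) 1 \<in> G"
      "Poly_Mapping.single (f * (2 * n + 1), f * (4 * n + 14)) 1 \<in> G"
      by (rule G_power, rule G_gen, simp add: monomial_gens_eq)+
    then have "Poly_Mapping.single (u * (6 * n + 15), u * 0) 1 *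
        Poly_Mapping.single (c * (4 * n + 7), c * (2 * n + 8)) 1 *
        Poly_Mapping.single (f * (2 * n + 1), f * (4 * n + 14)) 1 *
        Poly_Mapping.single (2 * v, j * (4 * n + 15) + 2 * i) 1 \<in> G"
      using G_odd[OF *(1)] by (intro G_mult)
    then show ?thesis unfolding w(1) * by (simp add: mult_single add_ac del: mult_0_right)
  qed
  have "f \<in> G" if "f \<in> high_part n 0" for f
  proof -
    have zero: "0 \<in> G" using G_gen[of "const2 0"] by (simp add: const2_def image_iff) (metis single_zero)
    have "Poly_Mapping.single w c \<in> G" if "w \<in> exponents n" for w c
      using G_mult[OF G_gen[of "const2 c"] G_monom[OF that]]
      by (simp add: const2_def mult_single flip: zero_prod_def)
    then have "(\<Sum>w\<in>A. Poly_Mapping.single w (Poly_Mapping.lookup f w)) \<in> G" if "A \<subseteq> exponents n" for A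
      using that by (induction A rule: infinite_finite_induct) (auto simp: zero intro!: G_add)
    then have "(\<Sum>w\<in>Poly_Mapping.keys f. Poly_Mapping.single w (Poly_Mapping.lookup f w)) \<in> G"
      using \<open>f \<in> high_part n 0\<close> unfolding high_part_def by blast
    then show ?thesis by (simp add: sum_of_monomials)
  qed
  moreover have "f \<in> high_part n 0" if "f \<in> G" for f
    using that unfolding G
  proof (induction rule: generate_ring.induct)
    case one
    show ?case using zero_in_exponents by (simp add: poly2_ring_def high_part_def)
  next
    case (incl h)
    have "const2 c \<in> high_part n 0" for c :: 'k
      using zero_in_exponents[of n] by (simp add: const2_def high_part_def zero_prod_def)
    moreover have "h \<in> high_part n 0" if "h \<in> monomial_gens n (2 * n + 8)"
      using monomial_gens_high that unfolding high_part_def by blast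
    ultimately show ?case using incl by blast
  next
    case (a_inv h)
    then show ?case by (simp add: poly2_ring_minus high_part_minus)
  next
    case (eng_add h1 h2)
    then show ?case using high_part_add by (simp add: poly2_ring_def)
  next
    case (eng_mult h1 h2)
    then show ?case using high_part_mult[of h1 n 0 h2 0] by (simp add: poly2_ring_def)
  qed
  ultimately show ?thesis unfolding G_def by blast
qed

lemma ideal_high_part: "ideal (high_part n e :: 'k::field poly2 set) (monomial_ring n (2 * n + 8))"
proof -
  interpret R: cring "monomial_ring n (2 * n + 8) :: 'k poly2 ring" by (rule cring_monomial_ring)
  have minus: "\<ominus>\<^bsub>monomial_ring n (2 * n + 8)\<^esub> f = - f"
    if "f \<in> high_part n e" for f :: "'k poly2"
  proof (rule R.minus_equality)
    show "f \<in> carrier (monomial_ring n (2 * n + 8))" "- f \<in> carrier (monomial_ring n (2 * n + 8))"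
      using that high_part_minus[OF that] unfolding carrier_monomial_ring high_part_def by auto
  qed (simp add: monomial_ring_simps)
  show ?thesis
  proof (rule idealI)
    show "subgroup (high_part n e :: 'k poly2 set) (add_monoid (monomial_ring n (2 * n + 8)))"
    proof (rule R.add.subgroupI)
      show "(high_part n e :: 'k poly2 set) \<subseteq> carrier (monomial_ring n (2 * n + 8))"
        unfolding carrier_monomial_ring high_part_def by auto
      have "0 \<in> (high_part n e :: 'k poly2 set)" by (simp add: high_part_def)
      then show "(high_part n e :: 'k poly2 set) \<noteq> {}" by blast
    next
      fix f :: "'k poly2" assume "f \<in> high_part n e"
      then show "\<ominus>\<^bsub>monomial_ring n (2 * n + 8)\<^esub> f \<in> high_part n e"
        using minus high_part_minus by metis
    qed (auto simp: monomial_ring_simps high_part_add)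
  next
    fix a x :: "'k poly2"
    assume "a \<in> high_part n e" "x \<in> carrier (monomial_ring n (2 * n + 8))"
    then show "x \<otimes>\<^bsub>monomial_ring n (2 * n + 8)\<^esub> a \<in> high_part n e"
      "a \<otimes>\<^bsub>monomial_ring n (2 * n + 8)\<^esub> x \<in> high_part n e"
      using high_part_mult[of x n 0 a e] high_part_mult[of a n e x 0]
      by (simp_all add: carrier_monomial_ring monomial_ring_simps)
  qed (rule R.ring_axioms)
qed

lemma hom_max_ideal:
  fixes n :: nat
  defines "I \<equiv> hom_max_ideal n (2 * n + 8) :: 'k::field poly2 set"
  shows "ideal I (monomial_ring n (2 * n + 8))"
    and "monomial_gens n (2 * n + 8) \<subseteq> I"
    and "I \<subseteq> high_part n (6 * n + 15)"
proof -
  interpret R: cring "monomial_ring n (2 * n + 8) :: 'k poly2 ring" by (rule cring_monomial_ring)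
  have "monomial_gens n (2 * n + 8) \<subseteq> carrier (monomial_ring n (2 * n + 8) :: 'k poly2 ring)"
    unfolding monomial_ring_def by (auto intro: generate_ring.incl)
  then show "ideal I (monomial_ring n (2 * n + 8))" "monomial_gens n (2 * n + 8) \<subseteq> I"
    unfolding I_def hom_max_ideal_def by (rule R.genideal_ideal, rule R.genideal_self)
  show "I \<subseteq> high_part n (6 * n + 15)"
    unfolding I_def hom_max_ideal_def
    by (rule R.genideal_minimal[OF ideal_high_part monomial_gens_high])
qed

lemma ideal_pow_high:
  "ideal_pow (monomial_ring n (2 * n + 8)) (hom_max_ideal n (2 * n + 8)) k \<subseteq>
     (high_part n (k * (6 * n + 15)) :: 'k::field poly2 set)"
proof (induction k)
  case 0
  show ?case by (simp add: carrier_monomial_ring)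
next
  case (Suc k)
  show ?case
  proof
    fix f :: "'k poly2"
    assume "f \<in> ideal_pow (monomial_ring n (2 * n + 8)) (hom_max_ideal n (2 * n + 8)) (Suc k)"
    then have "f \<in> ideal_prod (monomial_ring n (2 * n + 8)) (hom_max_ideal n (2 * n + 8))
        (ideal_pow (monomial_ring n (2 * n + 8)) (hom_max_ideal n (2 * n + 8)) k)" by simp
    then show "f \<in> high_part n (Suc k * (6 * n + 15))"
    proof (induction rule: ideal_prod.induct)
      case (prod f g)
      then have "f \<in> high_part n (6 * n + 15)" "g \<in> high_part n (k * (6 * n + 15))"
        using hom_max_ideal(3) Suc.IH by blast+
      from high_part_mult[OF this] show ?case by (simp add: monomial_ring_simps)
    next
      case (sum f g)
      then show ?case using high_part_add by (simp add: monomial_ring_simps)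
    qed
  qed
qed

lemma gen_power_in_ideal_pow:
  assumes "Poly_Mapping.single (p, q) 1 \<in> (monomial_gens n (2 * n + 8) :: 'k::field poly2 set)"
  shows "Poly_Mapping.single (k * p, k * q) 1 \<in>
    ideal_pow (monomial_ring n (2 * n + 8)) (hom_max_ideal n (2 * n + 8) :: 'k poly2 set) k"
proof (induction k)
  case 0
  interpret R: cring "monomial_ring n (2 * n + 8) :: 'k poly2 ring" by (rule cring_monomial_ring)
  show ?case using R.one_closed by (simp add: monomial_ring_simps flip: zero_prod_def)
next
  case (Suc k)
  have "Poly_Mapping.single (p, q) 1 \<in> (hom_max_ideal n (2 * n + 8) :: 'k poly2 set)"
    using hom_max_ideal(2) assms by blast
  from ideal_prod.prod[OF this Suc, of "monomial_ring n (2 * n + 8)"] show ?case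
    by (simp add: monomial_ring_simps mult_single)
qed

lemma high_part_times_saturation:
  assumes n: "n \<ge> 1" and f: "f \<in> high_part n (2 * (6 * n + 15))"
    and g: "Poly_Mapping.single (k * (6 * n + 15), 0) 1 * g \<in> high_part n 0"
      "Poly_Mapping.single (0, k * (6 * n + 15)) 1 * g \<in> high_part n 0"
  shows "f * g \<in> high_part n 0"
proof -
  have "w \<in> exponents n" if w_key: "w \<in> Poly_Mapping.keys (f * g)" for w
  proof -
    obtain u v where w: "w = u + v" "u \<in> Poly_Mapping.keys f" "v \<in> Poly_Mapping.keys g"
      using w_key keys_mult[of f g] by blast
    have v: "v + (k * (6 * n + 15), 0) \<in> exponents n" "v + (0, k * (6 * n + 15)) \<in> exponents n"
      using g w(3) unfolding high_part_def mem_Collect_eq single_mult_keys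
      by (simp_all add: add.commute[of v])
    show ?thesis
      unfolding w(1) using f w(2) by (intro exponents_absorb[OF n _ _ v]) (auto simp: high_part_def)
  qed
  then show ?thesis unfolding high_part_def by simp
qed

text \<open>
  A linear map on a power of the maximal ideal is multiplication by the fraction \<open>\<phi> X / X\<close>. Here it is
  a polynomial: with \<open>X\<close> a power of \<open>s\<close> and \<open>Y\<close> a power of \<open>t\<close> in the ideal, \<open>Y \<phi> X = X \<phi> Y\<close>
  forces \<open>X\<close> to divide \<open>\<phi> X\<close>.
\<close>
lemma linear_map_fraction:
  fixes \<phi> :: "'k::field poly2 \<Rightarrow> 'k poly2"
  assumes \<phi>: "linear_map (monomial_ring n (2 * n + 8))
      (self_module (monomial_ring n (2 * n + 8))\<lparr>carrier := 
        ideal_pow (monomial_ring n (2 * n + 8)) (hom_max_ideal n (2 * n + 8)) k\<rparr>)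
      (self_module (monomial_ring n (2 * n + 8))) \<phi>"
  obtains g where "\<And>u. u \<in> ideal_pow (monomial_ring n (2 * n + 8)) (hom_max_ideal n (2 * n + 8)) k \<Longrightarrow>
      \<phi> u = u * g"
proof -
  let ?R = "monomial_ring n (2 * n + 8) :: 'k poly2 ring"
  let ?P = "ideal_pow ?R (hom_max_ideal n (2 * n + 8)) k"
  let ?D = "6 * n + 15"
  let ?X = "Poly_Mapping.single (k * ?D, 0) 1 :: 'k poly2"
  let ?Y = "Poly_Mapping.single (0, k * ?D) 1 :: 'k poly2"
  have carr: "u \<in> high_part n 0" if "u \<in> ?P" for u
    using ideal_pow_high[of n k] that unfolding high_part_def by blast
  have \<phi>m: "\<phi> (a * u) = a * \<phi> u" if "a \<in> high_part n 0" "u \<in> ?P" for a u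
    using linear_map_simps(3)[OF \<phi>, of a u] that
    by (simp add: self_module_def carrier_monomial_ring monomial_ring_simps)
  have X: "?X \<in> ?P" using gen_power_in_ideal_pow[OF pure_powers_in_gens(1), of k n] by simp
  have Y: "?Y \<in> ?P" using gen_power_in_ideal_pow[OF pure_powers_in_gens(2), of k n] by simp
  have comm: "?Y * \<phi> ?X = ?X * \<phi> ?Y"
    using \<phi>m[OF carr[OF Y] X] \<phi>m[OF carr[OF X] Y] by (simp add: mult.commute)
  have "Poly_Mapping.keys (\<phi> ?X) \<subseteq> range ((+) (k * ?D, 0))"
  proof
    fix w assume "w \<in> Poly_Mapping.keys (\<phi> ?X)"
    then have "(0, k * ?D) + w \<in> Poly_Mapping.keys (?X * \<phi> ?Y)"
      unfolding comm[symmetric] single_mult_keys by blast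
    then obtain v where "(0, k * ?D) + w = (k * ?D, 0) + v"
      unfolding single_mult_keys by blast
    then have "w = (k * ?D, 0) + (fst v, snd w)" by (simp add: prod_eq_iff)
    then show "w \<in> range ((+) (k * ?D, 0))" by blast
  qed
  then obtain g where g: "\<phi> ?X = ?X * g" by (rule single_dvd)
  have "\<phi> u = u * g" if "u \<in> ?P" for u
  proof -
    have "?X * \<phi> u = u * \<phi> ?X"
      using \<phi>m[OF carr[OF X] that] \<phi>m[OF carr[OF that] X] by (simp add: mult.commute)
    then have "?X * \<phi> u = ?X * (u * g)" unfolding g by (simp add: mult_ac)
    then show ?thesis unfolding single_mult_cancel .
  qed
  then show ?thesis using that by blast
qed

section \<open>The strict Buchsbaum property\<close>

theorem theorem1p2:
  fixes n r :: nat
    and \<epsilon> :: "'k::field poly2 \<Rightarrow> 'b"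
    and E :: "nat \<Rightarrow> ('k poly2, 'b) module"
    and d :: "nat \<Rightarrow> 'b \<Rightarrow> 'b"
  assumes "n \<ge> 1"
    and "r = 2 * n + 8"
    and "injective_resolution (monomial_ring n r) (self_module (monomial_ring n r)) \<epsilon> E d"
  shows "strictly_buchsbaum 2 (monomial_ring n r) (hom_max_ideal n r) E d"
proof -
  let ?D = "6 * n + 15"
  define R where "R = (monomial_ring n (2 * n + 8) :: 'k poly2 ring)"
  define I where "I = (hom_max_ideal n (2 * n + 8) :: 'k poly2 set)"
  interpret R: cring R unfolding R_def by (rule cring_monomial_ring)
  have I: "ideal I R" unfolding I_def R_def by (rule hom_max_ideal)
  have R_ops: "mult R = (*)" "add R = (+)" "zero R = 0"
    by (simp_all add: R_def monomial_ring_simps)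
  have carrier: "carrier R = high_part n 0" unfolding R_def by (rule carrier_monomial_ring)
  have pow_high: "ideal_pow R I k \<subseteq> high_part n (k * ?D)" for k
    unfolding R_def I_def by (rule ideal_pow_high)
  have pow_carrier: "ideal_pow R I k \<subseteq> carrier R" for k
    using pow_high[of k] unfolding carrier high_part_def by auto
  have X: "Poly_Mapping.single (k * ?D, 0) 1 \<in> ideal_pow R I k" for k
    using gen_power_in_ideal_pow[OF pure_powers_in_gens(1), of k n] by (simp add: R_def I_def)
  have Y: "Poly_Mapping.single (0, k * ?D) 1 \<in> ideal_pow R I k" for k
    using gen_power_in_ideal_pow[OF pure_powers_in_gens(2), of k n] by (simp add: R_def I_def)
  have x: "Poly_Mapping.single (?D, 0) 1 \<in> I"
    unfolding I_def using hom_max_ideal(2) pure_powers_in_gens(1) by blast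
  have reg: "y = \<zero>\<^bsub>R\<^esub>" if "y \<in> carrier R" "Poly_Mapping.single (?D, 0) 1 \<otimes>\<^bsub>R\<^esub> y = \<zero>\<^bsub>R\<^esub>" for y
    using that(2) single_mult_cancel[of "(?D, 0)" y 0] by (simp add: R_ops)
  have res: "injective_resolution R (self_module R) \<epsilon> E d"
    using assms(2,3) unfolding R_def by simp
  have H1: "annihilates (ideal_pow R I l) (local_cohomology R I E d 1) \<longleftrightarrow>
      (\<forall>k \<phi>. \<forall>a\<in>ideal_pow R I l.
        linear_map R (self_module R\<lparr>carrier := ideal_pow R I k\<rparr>) (self_module R) \<phi> \<longrightarrow>
        (\<exists>h\<in>carrier R. \<forall>u\<in>ideal_pow R I k. a \<otimes>\<^bsub>R\<^esub> \<phi> u = h \<otimes>\<^bsub>R\<^esub> u))" for l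
    by (rule annihilates_H1_iff[OF res I pow_carrier x]) (rule reg)
  have "annihilates (ideal_pow R I 2) (local_cohomology R I E d 1)"
    unfolding H1
  proof (intro allI ballI impI)
    fix k \<phi> a
    assume a: "a \<in> ideal_pow R I 2"
      and \<phi>: "linear_map R (self_module R\<lparr>carrier := ideal_pow R I k\<rparr>) (self_module R) \<phi>"
    obtain g where g: "\<And>u. u \<in> ideal_pow R I k \<Longrightarrow> \<phi> u = u * g"
      using linear_map_fraction[OF \<phi>[unfolded R_def I_def]] unfolding R_def I_def by blast
    have \<phi>R: "\<phi> u \<in> high_part n 0" if "u \<in> ideal_pow R I k" for u
      using linear_map_simps(1)[OF \<phi>] that by (simp add: self_module_def carrier)
    have "a * g \<in> high_part n 0"
      using subsetD[OF pow_high a] \<phi>R[OF X[of k]] \<phi>R[OF Y[of k]]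
      unfolding g[OF X] g[OF Y] by (rule high_part_times_saturation[OF assms(1)])
    then show "\<exists>h\<in>carrier R. \<forall>u\<in>ideal_pow R I k. a \<otimes>\<^bsub>R\<^esub> \<phi> u = h \<otimes>\<^bsub>R\<^esub> u"
      unfolding carrier by (intro bexI[of _ "a * g"]) (simp_all add: g R_ops mult_ac)
  qed
  moreover have "\<not> annihilates (ideal_pow R I 1) (local_cohomology R I E d 1)"
  proof
    \<comment> \<open>The witness is \<open>s\<^sup>p t\<^sup>q\<close> with \<open>q = 3r\<close> in degree \<open>2\<close>; four times the degree suffices to move it
        into the ring along both axes.\<close>
    let ?g = "Poly_Mapping.single (6 * n + 6, 6 * n + 24) 1 :: 'k poly2"
    assume ann: "annihilates (ideal_pow R I 1) (local_cohomology R I E d 1)"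
    have "sum_of_gens n 6 (6 * n + 24)"
      by (rule sum_of_gensI[of 3 0 0 _ 0]) auto
    moreover have "sum_of_gens n 6 (6 * n + 24 + 4 * ?D)"
      by (rule sum_of_gensI[of 0 0 6 _ "3 * n - 3"]) (use assms(1) in auto)
    ultimately have sat: "(6 * n + 6 + 4 * ?D, 6 * n + 24) \<in> exponents n"
      "(6 * n + 6, 6 * n + 24 + 4 * ?D) \<in> exponents n"
      unfolding exponents_def by (auto intro!: exI[of _ 6])
    then have g_sat: "Poly_Mapping.single (4 * ?D, 0) 1 * ?g \<in> high_part n 0"
      "Poly_Mapping.single (0, 4 * ?D) 1 * ?g \<in> high_part n 0"
      by (simp_all add: high_part_def mult_single ac_simps)
    have "u * ?g \<in> high_part n 0" if "u \<in> ideal_pow R I 2" for u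
      using subsetD[OF pow_high that] g_sat by (rule high_part_times_saturation[OF assms(1)])
    then have "linear_map R (self_module R\<lparr>carrier := ideal_pow R I 2\<rparr>) (self_module R) (\<lambda>u. u * ?g)"
      unfolding linear_map_def by (auto simp: self_module_def carrier R_ops algebra_simps)
    then have "\<exists>h\<in>carrier R. \<forall>u\<in>ideal_pow R I 2.
        Poly_Mapping.single (0, 1 * ?D) 1 \<otimes>\<^bsub>R\<^esub> (u * ?g) = h \<otimes>\<^bsub>R\<^esub> u"
      by (rule ann[unfolded H1, rule_format, OF Y])
    then obtain h where h: "h \<in> carrier R"
        "\<And>u. u \<in> ideal_pow R I 2 \<Longrightarrow> Poly_Mapping.single (0, ?D) 1 * (u * ?g) = h * u"
      unfolding R_ops mult_1 by blast
    have "Poly_Mapping.single (2 * ?D, 0) 1 * h =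
        Poly_Mapping.single (2 * ?D, 0) 1 * (Poly_Mapping.single (0, ?D) 1 * ?g)"
      using h(2)[OF X] by (simp add: mult_ac)
    then have "h = Poly_Mapping.single (6 * n + 6, 12 * n + 39) 1"
      unfolding single_mult_cancel by (simp add: mult_single)
    then have "(6 * n + 6, 12 * n + 39) \<in> exponents n" using h(1) by (simp add: carrier high_part_def)
    then obtain m where m: "18 * n + 45 = m * ?D" "sum_of_gens n m (12 * n + 39)"
      unfolding exponents_def by auto
    have "m * ?D = 3 * ?D" using m(1) by simp
    then have "m = 3" by (metis mult_cancel2 add_eq_0_iff_both_eq_0 zero_neq_numeral)
    then show False using m(2) not_sum_of_three_gens by blast
  qed
  ultimately show ?thesis unfolding strictly_buchsbaum_def assms(2) R_def I_def by simp
qed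

end
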